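(* Let $H$ be a fixed graph with no isolated vertices and let $d\ge1$ be a fixed integer. Then with probability tending to $1$ as $n\to\infty$, \[ \delta(G(H,n,p_d^-(H)))<d\qquad\text{and}\qquad \delta(G(H,n,p_d^+(H)))\ge d. \]
   Context: A copy of $H$ in $K_n$ is a subgraph of the complete graph on $[n]$ isomorphic to $H$. $G(H,n,p)$ is the random (multi)graph on $[n]$ obtained by including each copy of $H$ in $K_n$ independently with probability $p$ and taking the union; $\delta(\cdot)$ is minimum degree. Let $m_1(H)$ be the number of copies of $H$ in $K_n$ containing the vertex $1$, $\delta(H)$ the minimum degree of $H$, $\delta_d(H)=\lceil d/\delta(H)\rceil-1$, and $p_d^{\pm}(H)=\frac{\ln n+\delta_d(H)\ln\ln n\pm x(n)}{m_1(H)}$, where $x(n)$ is any function with $1\ll x(n)\ll\ln\ln n$. *)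

theory Defs
  imports "HOL-Probability.Probability" "HOL-Library.Landau_Symbols" "HOL-Library.Multiset"
begin

type_synonym 'a ugraph = "'a set \<times> 'a set set"
type_synonym 'a umultigraph = "'a set \<times> 'a set multiset"

abbreviation verts :: "'a set \<times> 'e \<Rightarrow> 'a set" where
  "verts G \<equiv> fst G"

abbreviation edges :: "'a set \<times> 'e \<Rightarrow> 'e" where
  "edges G \<equiv> snd G"

definition simple_graph :: "'a ugraph \<Rightarrow> bool" where
  "simple_graph G \<longleftrightarrow> finite (verts G) \<and> (\<forall>e\<in>edges G. e \<subseteq> verts G \<and> card e = 2)"

definition vdegree :: "'a ugraph \<Rightarrow> 'a \<Rightarrow> nat" where
  "vdegree G v = card {e \<in> edges G. v \<in> e}"

definition min_degree :: "'a ugraph \<Rightarrow> nat" where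
  "min_degree G = Min (vdegree G ` verts G)"

definition no_isolated_vertices :: "'a ugraph \<Rightarrow> bool" where
  "no_isolated_vertices G \<longleftrightarrow> (\<forall>v\<in>verts G. vdegree G v \<noteq> 0)"

text \<open>In a multigraph, parallel edges are counted with multiplicity.\<close>

definition multi_vdegree :: "'a umultigraph \<Rightarrow> 'a \<Rightarrow> nat" where
  "multi_vdegree G v = size {# e \<in># edges G. v \<in> e #}"

definition multi_min_degree :: "'a umultigraph \<Rightarrow> nat" where
  "multi_min_degree G = Min (multi_vdegree G ` verts G)"

definition complete_graph :: "'a set \<Rightarrow> 'a ugraph" where
  "complete_graph S = (S, {e. e \<subseteq> S \<and> card e = 2})"

definition is_subgraph :: "'a ugraph \<Rightarrow> 'a ugraph \<Rightarrow> bool" where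
  "is_subgraph F G \<longleftrightarrow> simple_graph F \<and> verts F \<subseteq> verts G \<and> edges F \<subseteq> edges G"

definition graph_isomorphic :: "'a ugraph \<Rightarrow> 'b ugraph \<Rightarrow> bool" where
  "graph_isomorphic F G \<longleftrightarrow>
     (\<exists>f. bij_betw f (verts F) (verts G) \<and> edges G = (\<lambda>e. f ` e) ` edges F)"

definition copies :: "'a ugraph \<Rightarrow> nat \<Rightarrow> nat ugraph set" where
  "copies H n = {C. is_subgraph C (complete_graph {1..n}) \<and> graph_isomorphic H C}"

definition m1 :: "'a ugraph \<Rightarrow> nat \<Rightarrow> nat" where
  "m1 H n = card {C \<in> copies H n. 1 \<in> verts C}"

text \<open>The parameter of \<^const>\<open>bernoulli_pmf\<close> is clamped to the unit interval.\<close>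

definition random_copies :: "'a ugraph \<Rightarrow> nat \<Rightarrow> real \<Rightarrow> nat ugraph set pmf" where
  "random_copies H n p =
     map_pmf (\<lambda>f. {C \<in> copies H n. f C}) (Pi_pmf (copies H n) False (\<lambda>_. bernoulli_pmf p))"

text \<open>The union of the chosen copies, as a simple graph (parallel edges merged) and as a
  multigraph (each edge as often as there are chosen copies containing it).\<close>

definition random_graph :: "'a ugraph \<Rightarrow> nat \<Rightarrow> real \<Rightarrow> nat ugraph pmf" where
  "random_graph H n p =
     map_pmf (\<lambda>S. ({1..n}, \<Union>C\<in>S. edges C)) (random_copies H n p)"

definition random_multigraph :: "'a ugraph \<Rightarrow> nat \<Rightarrow> real \<Rightarrow> nat umultigraph pmf" where
  "random_multigraph H n p =
     map_pmf (\<lambda>S. ({1..n}, \<Sum>C\<in>S. mset_set (edges C))) (random_copies H n p)"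

definition delta_d :: "'a ugraph \<Rightarrow> nat \<Rightarrow> int" where
  "delta_d H d = \<lceil>real d / real (min_degree H)\<rceil> - 1"

definition p_minus :: "'a ugraph \<Rightarrow> nat \<Rightarrow> (nat \<Rightarrow> real) \<Rightarrow> nat \<Rightarrow> real" where
  "p_minus H d x n =
     (ln (real n) + real_of_int (delta_d H d) * ln (ln (real n)) - x n) / real (m1 H n)"

definition p_plus :: "'a ugraph \<Rightarrow> nat \<Rightarrow> (nat \<Rightarrow> real) \<Rightarrow> nat \<Rightarrow> real" where
  "p_plus H d x n =
     (ln (real n) + real_of_int (delta_d H d) * ln (ln (real n)) + x n) / real (m1 H n)"

end

theory Submission
  imports Defs "HOL-Real_Asymp.Real_Asymp"
begin

text \<open>
  Write \<open>k = \<lceil>d / \<delta>(H)\<rceil> - 1\<close>, so that \<open>j\<close> copies with pairwise disjoint edge sets at a vertex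
  \<open>v\<close> force degree at least \<open>d\<close> as soon as \<open>j > k\<close>, while \<open>k\<close> copies in which \<open>v\<close> has minimum
  degree contribute less than \<open>d\<close>. By symmetry every vertex lies in \<open>m\<^sub>1\<close> copies and every pair of
  vertices in \<open>m\<^sub>1 (h - 1) / (n - 1)\<close> copies, where \<open>h\<close> is the number of vertices of \<open>H\<close>.

  Above the threshold, if \<open>v\<close> has degree less than \<open>d\<close> in the union, take a maximal family of chosen
  copies at \<open>v\<close> with disjoint edge sets at \<open>v\<close>. It has at most \<open>k\<close> members, and no copy through
  \<open>v\<close> meeting this family only in \<open>v\<close> is chosen. All but \<open>O(m\<^sub>1 / n)\<close> of the copies through \<open>v\<close> are
  of this kind, so a union bound over the families shows that the expected number of such \<open>v\<close> is
  \<open>O(exp (- x(n)))\<close>. This handles overlapping copies and the simple graph at once.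

  Below the threshold, the expected number of vertices lying in at most \<open>k\<close> chosen copies, in all
  of which they have minimum degree, is of order at least \<open>exp (x(n))\<close>, and these events are
  asymptotically pairwise independent, so Chebyshev's inequality applies.
\<close>

section \<open>Products of Bernoulli distributions and the second moment method\<close>

text \<open>\<open>measure_pmf_prob_product\<close> wants countable sets, so both factors are first
  cut down to the countable supports.\<close>

lemma measure_pair_pmf_Times:
  "measure_pmf.prob (pair_pmf M N) (A \<times> B) = measure_pmf.prob M A * measure_pmf.prob N B"
proof -
  have "measure_pmf.prob (pair_pmf M N) (A \<times> B) =
      measure_pmf.prob (pair_pmf M N) ((A \<inter> set_pmf M) \<times> (B \<inter> set_pmf N))"
    by (subst measure_Int_set_pmf[symmetric]) (simp add: Times_Int_Times)
  also have "\<dots> = measure_pmf.prob M A * measure_pmf.prob N B"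
    by (subst measure_pmf_prob_product)
       (auto simp: measure_Int_set_pmf intro: countable_subset[OF _ countable_set_pmf])
  finally show ?thesis .
qed

text \<open>\<open>P\<close> reads only the coordinates in \<open>J\<close> and \<open>Q\<close>
  only those outside. Splitting the product distribution into a pair over \<open>J\<close> and
  \<open>I - J\<close> turns the joint event into a rectangle.\<close>

lemma prob_Pi_pmf_indep:
  assumes "finite I" "J \<subseteq> I"
    and P: "\<And>f g. (\<And>x. x \<in> J \<Longrightarrow> f x = g x) \<Longrightarrow> P f = P g"
    and Q: "\<And>f g. (\<And>x. x \<in> I - J \<Longrightarrow> f x = g x) \<Longrightarrow> Q f = Q g"
  shows "measure_pmf.prob (Pi_pmf I dflt p) {f. P f \<and> Q f} =
         measure_pmf.prob (Pi_pmf I dflt p) {f. P f} * measure_pmf.prob (Pi_pmf I dflt p) {f. Q f}"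
proof -
  let ?F = "\<lambda>(f, g) x. if x \<in> J then f x else g x"
  let ?R = "pair_pmf (Pi_pmf J dflt p) (Pi_pmf (I - J) dflt p)"
  have "Pi_pmf I dflt p = Pi_pmf (J \<union> (I - J)) dflt p"
    using assms(2) by (simp add: Un_absorb1)
  also have "\<dots> = map_pmf ?F ?R"
    using assms(1,2) by (intro Pi_pmf_union) (auto intro: finite_subset)
  finally have I: "Pi_pmf I dflt p = map_pmf ?F ?R" .
  have PF: "P (?F (f, g)) = P f" for f g by (rule P) auto
  have QF: "Q (?F (f, g)) = Q g" for f g by (rule Q) auto
  have "?F -` {f. P f \<and> Q f} = {f. P f} \<times> {g. Q g}" using PF QF by auto
  moreover have "?F -` {f. P f} = {f. P f} \<times> UNIV" using PF by auto
  moreover have "?F -` {f. Q f} = UNIV \<times> {g. Q g}" using QF by auto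
  ultimately show ?thesis
    unfolding I by (simp add: measure_pair_pmf_Times)
qed

text \<open>The event prescribes every coordinate in \<open>W\<close> and leaves the others free, so
  it is a box whose probability factorises.\<close>

lemma prob_Pi_bernoulli_pmf_eq:
  assumes "finite I" "W \<subseteq> I" "S \<subseteq> W" "0 \<le> p" "p \<le> 1"
  shows "measure_pmf.prob (Pi_pmf I False (\<lambda>_. bernoulli_pmf p)) {f. {x \<in> W. f x} = S} =
         p ^ card S * (1 - p) ^ card (W - S)"
proof -
  let ?B = "\<lambda>x. if x \<in> W then {x \<in> S} else UNIV"
  have W: "finite W" using assms(2,1) by (rule finite_subset)
  have S: "finite S" using assms(3) W by (rule finite_subset)
  have "{f. {x \<in> W. f x} = S} = Pi I ?B"
  proof (intro set_eqI)
    fix f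
    have "f \<in> Pi I ?B \<longleftrightarrow> (\<forall>x\<in>W. f x = (x \<in> S))"
      using assms(2) by (fastforce simp: Pi_iff)
    also have "\<dots> \<longleftrightarrow> {x \<in> W. f x} = S" using assms(3) by blast
    finally show "f \<in> {f. {x \<in> W. f x} = S} \<longleftrightarrow> f \<in> Pi I ?B" by blast
  qed
  then have "measure_pmf.prob (Pi_pmf I False (\<lambda>_. bernoulli_pmf p)) {f. {x \<in> W. f x} = S} =
     (\<Prod>x\<in>I. measure_pmf.prob (bernoulli_pmf p) (?B x))"
    using assms(1) by (simp add: measure_Pi_pmf_Pi)
  also have "\<dots> = (\<Prod>x\<in>W. measure_pmf.prob (bernoulli_pmf p) (?B x))"
    using assms(1,2) by (intro prod.mono_neutral_right) auto
  also have "\<dots> = (\<Prod>x\<in>W. if x \<in> S then p else 1 - p)"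
    using assms by (intro prod.cong) (auto simp: measure_pmf_single)
  also have "\<dots> = p ^ card S * (1 - p) ^ card (W - S)"
    using W S assms(3) by (simp add: prod.If_cases Diff_eq Int_absorb1)
  finally show ?thesis .
qed

text \<open>Chebyshev for the number \<open>Y\<close> of events that occur. Diagonal pairs
  contribute \<open>\<mu>\<close> to the second moment and the others at most
  \<open>K * \<mu>\<^sup>2\<close>, so the variance is at most
  \<open>\<mu> + (K - 1) * \<mu>\<^sup>2\<close>.\<close>

lemma measure_pmf_second_moment:
  fixes E :: "'u \<Rightarrow> 'b set"
  assumes "finite U" "finite (set_pmf M)" "1 \<le> K"
    and pos: "(\<Sum>u\<in>U. measure_pmf.prob M (E u)) > 0"
    and pair: "\<And>u v. u \<in> U \<Longrightarrow> v \<in> U \<Longrightarrow> u \<noteq> v \<Longrightarrow>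
      measure_pmf.prob M (E u \<inter> E v) \<le> K * (measure_pmf.prob M (E u) * measure_pmf.prob M (E v))"
  shows "measure_pmf.prob M {\<omega>. \<forall>u\<in>U. \<omega> \<notin> E u} \<le>
         1 / (\<Sum>u\<in>U. measure_pmf.prob M (E u)) + (K - 1)"
proof -
  define \<mu> where "\<mu> = (\<Sum>u\<in>U. measure_pmf.prob M (E u))"
  define Y where "Y = (\<lambda>\<omega>. \<Sum>u\<in>U. indicator (E u) \<omega> :: real)"
  have int: "integrable (measure_pmf M) f" for f :: "'b \<Rightarrow> real"
    using assms(2) by (rule integrable_measure_pmf_finite)
  have EY: "measure_pmf.expectation M Y = \<mu>"
    unfolding Y_def \<mu>_def by (subst Bochner_Integration.integral_sum) (auto intro: int)
  have ind2: "indicator (E u) \<omega> * indicator (E v) \<omega> = (indicator (E u \<inter> E v) \<omega> :: real)" for u v \<omega>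
    by (simp add: indicator_inter_arith)
  have "measure_pmf.expectation M (\<lambda>\<omega>. (Y \<omega>)\<^sup>2) =
      measure_pmf.expectation M (\<lambda>\<omega>. \<Sum>u\<in>U. \<Sum>v\<in>U. indicator (E u \<inter> E v) \<omega>)"
    by (simp add: Y_def power2_eq_square sum_product ind2)
  also have "\<dots> = (\<Sum>u\<in>U. measure_pmf.expectation M (\<lambda>\<omega>. \<Sum>v\<in>U. indicator (E u \<inter> E v) \<omega>))"
    by (subst Bochner_Integration.integral_sum) (auto intro: int)
  also have "\<dots> = (\<Sum>u\<in>U. \<Sum>v\<in>U. measure_pmf.prob M (E u \<inter> E v))"
    by (intro sum.cong refl, subst Bochner_Integration.integral_sum) (auto intro: int)
  also have "\<dots> \<le> (\<Sum>u\<in>U. \<Sum>v\<in>U. (if u = v then measure_pmf.prob M (E u) else 0) +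
      K * (measure_pmf.prob M (E u) * measure_pmf.prob M (E v)))"
    using pair \<open>1 \<le> K\<close> by (intro sum_mono) auto
  also have "\<dots> = \<mu> + K * \<mu>\<^sup>2"
  proof -
    have "\<mu>\<^sup>2 = (\<Sum>u\<in>U. \<Sum>v\<in>U. measure_pmf.prob M (E u) * measure_pmf.prob M (E v))"
      by (simp add: \<mu>_def power2_eq_square sum_product)
    then show ?thesis
      using assms(1) by (simp add: sum.distrib \<mu>_def[symmetric] sum_distrib_left[symmetric])
  qed
  finally have EY2: "measure_pmf.expectation M (\<lambda>\<omega>. (Y \<omega>)\<^sup>2) \<le> \<mu> + K * \<mu>\<^sup>2" .
  \<comment> \<open>If no event occurs then \<open>Y\<close> is 0 and deviates from its mean by
    exactly \<open>\<mu>\<close>.\<close>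
  have "measure_pmf.prob M {\<omega>. \<forall>u\<in>U. \<omega> \<notin> E u} \<le>
      measure_pmf.prob M {\<omega>\<in>space M. \<bar>Y \<omega> - measure_pmf.expectation M Y\<bar> \<ge> \<mu>}"
    unfolding EY using pos by (intro measure_pmf.finite_measure_mono) (auto simp: Y_def \<mu>_def)
  also have "\<dots> \<le> measure_pmf.variance M Y / \<mu>\<^sup>2"
    using pos by (intro measure_pmf.Chebyshev_inequality) (auto simp: \<mu>_def intro: int)
  also have "measure_pmf.variance M Y = measure_pmf.expectation M (\<lambda>\<omega>. (Y \<omega>)\<^sup>2) - \<mu>\<^sup>2"
    by (subst measure_pmf.variance_eq) (auto simp: EY intro: int)
  also have "(measure_pmf.expectation M (\<lambda>\<omega>. (Y \<omega>)\<^sup>2) - \<mu>\<^sup>2) / \<mu>\<^sup>2 \<le> (\<mu> + K * \<mu>\<^sup>2 - \<mu>\<^sup>2) / \<mu>\<^sup>2"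
    using EY2 by (intro divide_right_mono) auto
  also have "\<dots> = 1 / \<mu> + (K - 1)"
    using pos by (simp add: \<mu>_def[symmetric] field_simps power2_eq_square)
  finally show ?thesis by (simp add: \<mu>_def)
qed

text \<open>Converse of \<open>1 - p \<le> exp (- p)\<close> up to a second-order term. The error
  stays bounded in the applications because \<open>m * p\<^sup>2\<close> tends to 0 there.\<close>

lemma one_minus_power_ge:
  fixes p :: real
  assumes "0 \<le> p" "p \<le> 1 / 2"
  shows "exp (- (real m * (p + 2 * p\<^sup>2))) \<le> (1 - p) ^ m"
proof -
  have "- p - 2 * p\<^sup>2 \<le> ln (1 - p)"
    using assms by (rule ln_one_minus_pos_lower_bound)
  then have "exp (- p - 2 * p\<^sup>2) \<le> 1 - p"
    using assms by (subst (asm) ln_ge_iff) auto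
  then have "exp (- p - 2 * p\<^sup>2) ^ m \<le> (1 - p) ^ m"
    by (intro power_mono) auto
  also have "exp (- p - 2 * p\<^sup>2) ^ m = exp (- (real m * (p + 2 * p\<^sup>2)))"
    by (simp add: exp_of_nat_mult[symmetric] algebra_simps)
  finally show ?thesis .
qed

section \<open>Copies of a fixed graph\<close>

text \<open>Makes copies of \<open>H\<close> the injective images of \<open>H\<close>, and lets
  transpositions of labels act on the set of copies.\<close>

definition relabel :: "('a \<Rightarrow> 'b) \<Rightarrow> 'a ugraph \<Rightarrow> 'b ugraph" where
  "relabel f G = (f ` verts G, (`) f ` edges G)"

lemma verts_relabel [simp]: "verts (relabel f G) = f ` verts G"
  by (simp add: relabel_def)

lemma edges_relabel [simp]: "edges (relabel f G) = (`) f ` edges G"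
  by (simp add: relabel_def)

lemma relabel_transpose_involutory [simp]:
  "relabel (Transposition.transpose a b) (relabel (Transposition.transpose a b) G) = G"
  by (simp add: relabel_def image_image prod_eq_iff)

lemma graph_isomorphic_iff_relabel:
  "graph_isomorphic F G \<longleftrightarrow> (\<exists>f. inj_on f (verts F) \<and> G = relabel f F)"
  by (auto simp: graph_isomorphic_def relabel_def bij_betw_def prod_eq_iff)

lemma vdegree_relabel:
  assumes "simple_graph G" "inj_on f (verts G)" "v \<in> verts G"
  shows "vdegree (relabel f G) (f v) = vdegree G v"
proof -
  have sub: "e \<subseteq> verts G" if "e \<in> edges G" for e
    using assms(1) that by (auto simp: simple_graph_def)
  have "{e \<in> (`) f ` edges G. f v \<in> e} = (`) f ` {e \<in> edges G. v \<in> e}"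
    using inj_on_image_mem_iff[OF assms(2,3) sub] by blast
  moreover have "inj_on ((`) f) {e \<in> edges G. v \<in> e}"
    using inj_on_image_Pow[OF assms(2)] sub by (auto intro: inj_on_subset)
  ultimately show ?thesis
    by (simp add: vdegree_def card_image)
qed

lemma simple_graph_finite_edges: "simple_graph G \<Longrightarrow> finite (edges G)"
  by (rule finite_subset[of _ "Pow (verts G)"]) (auto simp: simple_graph_def)

lemma vdegree_eq_0: "simple_graph G \<Longrightarrow> v \<notin> verts G \<Longrightarrow> vdegree G v = 0"
  unfolding vdegree_def simple_graph_def by (subst card_eq_0_iff) blast

lemma min_degree_less_iff:
  assumes "n \<ge> 1"
  shows "min_degree ({1..n}, E) < d \<longleftrightarrow> (\<exists>v\<in>{1..n::nat}. vdegree ({1..n}, E) v < d)"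
  unfolding min_degree_def using assms by (subst Min_less_iff) auto

lemma multi_min_degree_less_iff:
  assumes "n \<ge> 1"
  shows "multi_min_degree ({1..n}, E) < d \<longleftrightarrow> (\<exists>v\<in>{1..n::nat}. multi_vdegree ({1..n}, E) v < d)"
  unfolding multi_min_degree_def using assms by (subst Min_less_iff) auto

lemma multi_vdegree_sum:
  assumes "finite T"
  shows "multi_vdegree (V, \<Sum>C\<in>T. mset_set (edges C)) v =
    (\<Sum>C\<in>T. size (filter_mset (\<lambda>e. v \<in> e) (mset_set (edges C))))"
  using assms by (induction T rule: finite_induct) (simp_all add: multi_vdegree_def)

lemma multi_vdegree_sum_simple:
  assumes "finite T" "\<And>C. C \<in> T \<Longrightarrow> simple_graph C"
  shows "multi_vdegree (V, \<Sum>C\<in>T. mset_set (edges C)) v = (\<Sum>C\<in>T. vdegree C v)"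
  unfolding multi_vdegree_sum[OF assms(1)]
  by (rule sum.cong) (auto simp: vdegree_def filter_mset_mset_set simple_graph_finite_edges assms(2))

text \<open>Merging parallel edges can only lower a degree. This comparison lets each threshold
  statement be proved for one model and transferred to the other.\<close>

lemma vdegree_UN_le:
  assumes "finite T" "\<And>C. C \<in> T \<Longrightarrow> simple_graph C"
  shows "vdegree (V, \<Union>C\<in>T. edges C) v \<le> multi_vdegree (V, \<Sum>C\<in>T. mset_set (edges C)) v"
proof -
  have "vdegree (V, \<Union>C\<in>T. edges C) v = card (\<Union>C\<in>T. {e \<in> edges C. v \<in> e})"
    unfolding vdegree_def by (rule arg_cong[of _ _ card]) auto
  also have "\<dots> \<le> (\<Sum>C\<in>T. card {e \<in> edges C. v \<in> e})"
    using assms(1) by (rule card_UN_le)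
  finally show ?thesis
    using assms by (simp add: multi_vdegree_sum_simple vdegree_def)
qed

lemma sum_card_swap:
  assumes "finite A" "finite B"
  shows "(\<Sum>a\<in>A. card {b \<in> B. P a b}) = (\<Sum>b\<in>B. card {a \<in> A. P a b})"
proof -
  have "card {b \<in> B. P a b} = (\<Sum>b\<in>B. if P a b then 1 else 0)" for a
    using assms(2) by (simp add: sum.If_cases Collect_conj_eq)
  moreover have "card {a \<in> A. P a b} = (\<Sum>a\<in>A. if P a b then 1 else 0)" for b
    using assms(1) by (simp add: sum.If_cases Collect_conj_eq)
  ultimately show ?thesis
    by (simp only: sum.swap[of _ A B])
qed

text \<open>Nonemptiness keeps \<open>Min\<close> in \<open>min_degree\<close> away from the empty
  set; together with the absence of isolated vertices it makes the minimum degree positive.\<close>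

locale nonisolated_graph =
  fixes H :: "'a ugraph"
  assumes simple: "simple_graph H" and nonempty: "verts H \<noteq> {}"
    and no_isolated: "no_isolated_vertices H"
begin

abbreviation h :: nat where "h \<equiv> card (verts H)"

abbreviation through :: "nat \<Rightarrow> nat \<Rightarrow> nat ugraph set" where
  "through n v \<equiv> {C \<in> copies H n. v \<in> verts C}"

lemma finite_verts: "finite (verts H)"
  using simple by (simp add: simple_graph_def)

lemma min_degree_le: "a \<in> verts H \<Longrightarrow> min_degree H \<le> vdegree H a"
  using finite_verts by (simp add: min_degree_def)

lemma min_degree_attained: "\<exists>a\<in>verts H. vdegree H a = min_degree H"
proof -
  have "min_degree H \<in> vdegree H ` verts H"
    unfolding min_degree_def using finite_verts nonempty by (intro Min_in) auto
  then show ?thesis by auto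
qed

lemma min_degree_pos: "min_degree H > 0"
  using min_degree_attained no_isolated by (auto simp: no_isolated_vertices_def)

lemma h_ge_2: "h \<ge> 2"
proof -
  obtain a where "vdegree H a \<noteq> 0"
    using nonempty no_isolated by (auto simp: no_isolated_vertices_def)
  then obtain e where "e \<in> edges H"
    unfolding vdegree_def by (metis (mono_tags, lifting) Collect_empty_eq card.empty)
  then have "e \<subseteq> verts H" "card e = 2" using simple by (auto simp: simple_graph_def)
  then show ?thesis using finite_verts by (metis card_mono)
qed

lemma copiesE:
  assumes "C \<in> copies H n"
  obtains f where "inj_on f (verts H)" "C = relabel f H" "f ` verts H \<subseteq> {1..n}"
  using assms by (auto simp: copies_def graph_isomorphic_iff_relabel is_subgraph_def complete_graph_def)

lemma relabel_in_copies:
  assumes "inj_on f (verts H)" "f ` verts H \<subseteq> {1..n}"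
  shows "relabel f H \<in> copies H n"
proof -
  have e: "e \<subseteq> verts H" "card e = 2" if "e \<in> edges H" for e
    using simple that by (auto simp: simple_graph_def)
  have "card (f ` e) = 2" if "e \<in> edges H" for e
    using e[OF that] assms(1) by (metis card_image inj_on_subset)
  then have "simple_graph (relabel f H)"
    using e finite_verts by (auto simp: simple_graph_def)
  then show ?thesis
    using assms e by (auto simp: copies_def graph_isomorphic_iff_relabel is_subgraph_def
      complete_graph_def simple_graph_def)
qed

lemma finite_copies: "finite (copies H n)"
proof (rule finite_subset)
  show "copies H n \<subseteq> Pow {1..n} \<times> Pow (Pow {1..n})"
    by (auto simp: copies_def is_subgraph_def complete_graph_def)
qed simp

lemma copies_simple: "C \<in> copies H n \<Longrightarrow> simple_graph C"
  by (simp add: copies_def is_subgraph_def)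

lemma verts_copies: "C \<in> copies H n \<Longrightarrow> verts C \<subseteq> {1..n}"
  by (simp add: copies_def is_subgraph_def complete_graph_def)

lemma card_verts_copies: "C \<in> copies H n \<Longrightarrow> card (verts C) = h"
  by (elim copiesE) (simp add: card_image)

lemma min_degree_le_copies:
  assumes "C \<in> copies H n" "v \<in> verts C"
  shows "min_degree H \<le> vdegree C v"
  using assms by (elim copiesE) (auto simp: vdegree_relabel simple intro: min_degree_le)

lemma min_degree_attained_copies:
  assumes "C \<in> copies H n"
  shows "\<exists>v\<in>verts C. vdegree C v = min_degree H"
proof -
  obtain f where f: "inj_on f (verts H)" "C = relabel f H"
    using assms by (elim copiesE)
  obtain a where "a \<in> verts H" "vdegree H a = min_degree H"
    using min_degree_attained by auto
  then show ?thesis using f by (auto simp: vdegree_relabel simple)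
qed

section \<open>Counting copies by symmetry and double counting\<close>

lemma relabel_transpose_copies:
  assumes "C \<in> copies H n" "a \<in> {1..n}" "b \<in> {1..n}"
  shows "relabel (Transposition.transpose a b) C \<in> copies H n"
proof -
  obtain f where f: "inj_on f (verts H)" "C = relabel f H" "f ` verts H \<subseteq> {1..n}"
    using assms(1) by (elim copiesE)
  have "relabel (Transposition.transpose a b) C = relabel (Transposition.transpose a b \<circ> f) H"
    by (simp add: f(2) relabel_def image_comp)
  moreover have "(Transposition.transpose a b \<circ> f) ` verts H \<subseteq> {1..n}"
  proof -
    have "(Transposition.transpose a b \<circ> f) ` verts H \<subseteq> Transposition.transpose a b ` {1..n}"
      unfolding image_comp[symmetric] by (rule image_mono[OF f(3)])
    then show ?thesis using assms(2,3) by simp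
  qed
  moreover have "inj_on (Transposition.transpose a b \<circ> f) (verts H)"
    using f(1) by (simp add: comp_inj_on)
  ultimately show ?thesis by (simp only: relabel_in_copies)
qed

text \<open>Swapping two labels is an involution of the set of copies, so it preserves the number of
  copies with a given property. All symmetry arguments below rest on this.\<close>

lemma card_copies_transpose:
  assumes "a \<in> {1..n}" "b \<in> {1..n}"
  shows "card {C \<in> copies H n. Q (relabel (Transposition.transpose a b) C)} = card {C \<in> copies H n. Q C}"
  by (rule bij_betw_same_card[of "relabel (Transposition.transpose a b)"], rule bij_betw_byWitness[where f' = "relabel (Transposition.transpose a b)"])
     (auto simp: relabel_transpose_copies[OF _ assms] image_iff simp del: One_nat_def)

lemma mem_transpose_image: "v \<in> Transposition.transpose a b ` S \<longleftrightarrow> Transposition.transpose a b v \<in> S"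
  by (metis image_iff transpose_involutory)

lemma card_through:
  assumes "v \<in> {1..n}"
  shows "card (through n v) = m1 H n"
proof -
  have "card (through n v) = card {C \<in> copies H n. v \<in> verts (relabel (Transposition.transpose 1 v) C)}"
    using assms by (intro card_copies_transpose[symmetric]) auto
  also have "\<dots> = m1 H n"
    unfolding m1_def by (simp add: mem_transpose_image)
  finally show ?thesis .
qed

definition codegree :: "nat \<Rightarrow> nat \<Rightarrow> nat \<Rightarrow> nat" where
  "codegree n u v = card (through n u \<inter> through n v)"

text \<open>By symmetry \<open>codegree n u w\<close> is the same for all \<open>w\<close> other
  than \<open>u\<close>. Counting the pairs of such a \<open>w\<close> and a copy through both in
  two ways gives the identity, as each copy through \<open>u\<close> has \<open>h - 1\<close>
  further vertices.\<close>

lemma codegree_eq: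
  assumes "u \<in> {1..n}" "v \<in> {1..n}" "u \<noteq> v"
  shows "(n - 1) * codegree n u v = (h - 1) * m1 H n"
proof -
  have sym: "codegree n u w = codegree n u v" if "w \<in> {1..n} - {u}" for w
  proof -
    have "codegree n u w = card {C \<in> copies H n. u \<in> verts C \<and> w \<in> verts C}"
      unfolding codegree_def by (rule arg_cong[of _ _ card]) auto
    also have "\<dots> = card {C \<in> copies H n. u \<in> verts (relabel (Transposition.transpose v w) C) \<and>
        w \<in> verts (relabel (Transposition.transpose v w) C)}"
      using assms that by (intro card_copies_transpose[symmetric]) auto
    also have "\<dots> = card {C \<in> copies H n. u \<in> verts C \<and> v \<in> verts C}"
      using assms that by (simp add: mem_transpose_image)
    also have "\<dots> = codegree n u v"
      unfolding codegree_def by (rule arg_cong[of _ _ card]) auto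
    finally show ?thesis .
  qed
  have "(n - 1) * codegree n u v = (\<Sum>w\<in>{1..n} - {u}. codegree n u w)"
    using assms(1) by (simp add: sym)
  also have "\<dots> = (\<Sum>w\<in>{1..n} - {u}. card {C \<in> through n u. w \<in> verts C})"
    unfolding codegree_def by (intro sum.cong refl arg_cong[of _ _ card]) auto
  also have "\<dots> = (\<Sum>C\<in>through n u. card {w \<in> {1..n} - {u}. w \<in> verts C})"
    using finite_copies by (intro sum_card_swap) auto
  also have "\<dots> = (\<Sum>C\<in>through n u. h - 1)"
  proof (rule sum.cong[OF refl])
    fix C assume C: "C \<in> through n u"
    then have "{w \<in> {1..n} - {u}. w \<in> verts C} = verts C - {u}"
      using verts_copies by blast
    moreover have "card (verts C) = h" using C by (blast intro: card_verts_copies)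
    ultimately show "card {w \<in> {1..n} - {u}. w \<in> verts C} = h - 1"
      using C by simp
  qed
  also have "\<dots> = (h - 1) * m1 H n"
    using card_through[OF assms(1)] by simp
  finally show ?thesis .
qed

text \<open>The copies that contribute as little as possible to the degree of
  \<open>v\<close>.\<close>

definition light :: "nat \<Rightarrow> nat \<Rightarrow> nat ugraph set" where
  "light n v = {C \<in> through n v. vdegree C v = min_degree H}"

text \<open>Every copy has at least one vertex of minimum degree among its \<open>h\<close>
  vertices. Summed over all vertices, light incidences are at least a fraction \<open>1 / h\<close>
  of all incidences, and by symmetry the same holds at each vertex.\<close>

lemma card_light:
  assumes "v \<in> {1..n}"
  shows "m1 H n \<le> h * card (light n v)"
proof -
  have sym: "card (light n w) = card (light n v)" if "w \<in> {1..n}" for w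
  proof -
    have "card (light n w) = card {C \<in> copies H n. w \<in> verts C \<and> vdegree C w = min_degree H}"
      unfolding light_def by (rule arg_cong[of _ _ card]) auto
    also have "\<dots> = card {C \<in> copies H n. w \<in> verts (relabel (Transposition.transpose v w) C) \<and>
        vdegree (relabel (Transposition.transpose v w) C) w = min_degree H}"
      using assms that by (intro card_copies_transpose[symmetric]) auto
    also have "\<dots> = card {C \<in> copies H n. v \<in> verts C \<and> vdegree C v = min_degree H}"
    proof (rule arg_cong[of _ _ card], rule Collect_cong, rule conj_cong[OF refl])
      fix C assume "C \<in> copies H n"
      then have "vdegree (relabel (Transposition.transpose v w) C) w = vdegree C v" if "v \<in> verts C"
        using vdegree_relabel[of C "Transposition.transpose v w" v] that copies_simple by simp
      then show "w \<in> verts (relabel (Transposition.transpose v w) C) \<and>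
          vdegree (relabel (Transposition.transpose v w) C) w = min_degree H \<longleftrightarrow>
          v \<in> verts C \<and> vdegree C v = min_degree H"
        by (auto simp: mem_transpose_image)
    qed
    also have "\<dots> = card (light n v)"
      unfolding light_def by (rule arg_cong[of _ _ card]) auto
    finally show ?thesis .
  qed
  have "n * m1 H n = (\<Sum>w\<in>{1..n}. card (through n w))"
    by (simp add: card_through)
  also have "\<dots> = (\<Sum>C\<in>copies H n. card {w \<in> {1..n}. w \<in> verts C})"
    using finite_copies by (intro sum_card_swap) auto
  also have "\<dots> \<le> (\<Sum>C\<in>copies H n. h * card {w \<in> {1..n}. w \<in> verts C \<and> vdegree C w = min_degree H})"
  proof (rule sum_mono)
    fix C assume C: "C \<in> copies H n"
    then have "{w \<in> {1..n}. w \<in> verts C} = verts C" using verts_copies by blast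
    then have "card {w \<in> {1..n}. w \<in> verts C} = h" using card_verts_copies[OF C] by simp
    moreover have "1 \<le> card {w \<in> {1..n}. w \<in> verts C \<and> vdegree C w = min_degree H}"
    proof -
      obtain w where "w \<in> verts C" "vdegree C w = min_degree H"
        using min_degree_attained_copies[OF C] by blast
      then have "w \<in> {w \<in> {1..n}. w \<in> verts C \<and> vdegree C w = min_degree H}"
        using verts_copies[OF C] by blast
      then have "card {w \<in> {1..n}. w \<in> verts C \<and> vdegree C w = min_degree H} \<noteq> 0"
        by (subst card_0_eq) auto
      then show ?thesis by linarith
    qed
    ultimately show "card {w \<in> {1..n}. w \<in> verts C} \<le>
        h * card {w \<in> {1..n}. w \<in> verts C \<and> vdegree C w = min_degree H}"
      by (metis mult_le_mono2 mult.right_neutral)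
  qed
  also have "\<dots> = h * (\<Sum>w\<in>{1..n}. card {C \<in> copies H n. w \<in> verts C \<and> vdegree C w = min_degree H})"
    unfolding sum_distrib_left[symmetric]
    using finite_copies by (subst sum_card_swap) auto
  also have "(\<Sum>w\<in>{1..n}. card {C \<in> copies H n. w \<in> verts C \<and> vdegree C w = min_degree H}) =
      (\<Sum>w\<in>{1..n}. card (light n w))"
    unfolding light_def by (intro sum.cong refl arg_cong[of _ _ card]) auto
  also have "\<dots> = n * card (light n v)"
    by (simp add: sym)
  finally show ?thesis using assms by simp
qed

lemma copies_nonempty:
  assumes "n \<ge> h"
  shows "copies H n \<noteq> {}"
proof -
  obtain f where "f ` verts H \<subseteq> {1..n}" "inj_on f (verts H)"
    using card_le_inj[of "verts H" "{1..n}"] finite_verts assms by auto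
  then show ?thesis using relabel_in_copies by blast
qed

text \<open>Any pair of vertices inside some copy has codegree at least 1, and
  \<open>codegree_eq\<close> then bounds \<open>m1\<close> from below. Linear growth of
  \<open>m1\<close> is what makes the threshold probabilities \<open>O(ln n / n)\<close>.\<close>

lemma m1_ge:
  assumes "n \<ge> h"
  shows "n - 1 \<le> (h - 1) * m1 H n"
proof -
  obtain C where C: "C \<in> copies H n" using copies_nonempty[OF assms] by auto
  then have "\<exists>T\<subseteq>verts C. card T = 2"
    using h_ge_2 by (metis card_verts_copies obtain_subset_with_card_n)
  then obtain u v where uv: "u \<in> verts C" "v \<in> verts C" "u \<noteq> v"
    by (auto simp: card_2_iff)
  then have "codegree n u v \<noteq> 0"
    using C finite_copies by (auto simp: codegree_def)
  moreover have "(n - 1) * codegree n u v = (h - 1) * m1 H n"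
    using uv verts_copies[OF C] by (intro codegree_eq) auto
  ultimately show ?thesis by (metis bot_nat_0.not_eq_extremum mult_le_mono2 nat_mult_1_right Suc_leI One_nat_def)
qed

text \<open>\<open>S\<close> is a maximal family of copies in \<open>T\<close> through
  \<open>v\<close> whose edge sets at \<open>v\<close> are pairwise disjoint. Disjointness makes
  their degrees at \<open>v\<close> add up, which bounds \<open>card S\<close>; maximality forces
  every other copy in \<open>T\<close> through \<open>v\<close> to share an edge at
  \<open>v\<close>, hence a second vertex, with a member.\<close>

lemma low_degree_family:
  assumes T: "T \<subseteq> copies H n" and deg: "vdegree (V, \<Union>C\<in>T. edges C) v < d"
  obtains S where "S \<subseteq> T" "S \<subseteq> through n v" "min_degree H * card S < d"
    "\<And>C. C \<in> T \<Longrightarrow> v \<in> verts C \<Longrightarrow> \<exists>D\<in>S. \<exists>w\<in>verts C \<inter> verts D. w \<noteq> v"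
proof -
  define E where "E = (\<lambda>C :: nat ugraph. {e \<in> edges C. v \<in> e})"
  define F where "F = {S. S \<subseteq> T \<inter> through n v \<and> (\<forall>C\<in>S. \<forall>D\<in>S. C \<noteq> D \<longrightarrow> E C \<inter> E D = {})}"
  have "finite F"
    by (rule finite_subset[of _ "Pow (copies H n)"]) (auto simp: F_def finite_copies)
  moreover have "{} \<in> F" by (simp add: F_def)
  ultimately obtain S where S: "S \<in> F" "\<And>S'. S' \<in> F \<Longrightarrow> S \<subseteq> S' \<Longrightarrow> S = S'"
    using finite_has_maximal[of F] by blast
  have ST: "S \<subseteq> T" "S \<subseteq> through n v" and disj: "\<forall>C\<in>S. \<forall>D\<in>S. C \<noteq> D \<longrightarrow> E C \<inter> E D = {}"
    using S(1) by (auto simp: F_def)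
  have finS: "finite S" using ST(2) finite_copies by (auto intro: finite_subset)
  have finT: "finite T" using T finite_copies by (rule finite_subset)
  have finE: "finite (E C)" if "C \<in> copies H n" for C
    using simple_graph_finite_edges[OF copies_simple[OF that]] by (simp add: E_def)
  have deg': "min_degree H \<le> card (E C)" if "C \<in> through n v" for C
    using min_degree_le_copies[of C n v] that by (simp add: vdegree_def E_def)
  have "min_degree H * card S = (\<Sum>C\<in>S. min_degree H)" by simp
  also have "\<dots> \<le> (\<Sum>C\<in>S. card (E C))" using deg' ST(2) by (intro sum_mono) auto
  also have "\<dots> = card (\<Union>C\<in>S. E C)"
    using disj finE ST(2) finS by (intro card_UN_disjoint[symmetric]) auto
  also have "\<dots> \<le> card (\<Union>C\<in>T. E C)"
    using ST(1) finT finE T by (intro card_mono) auto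
  also have "(\<Union>C\<in>T. E C) = {e \<in> (\<Union>C\<in>T. edges C). v \<in> e}" by (auto simp: E_def)
  also have "card \<dots> < d" using deg by (simp add: vdegree_def)
  finally have "min_degree H * card S < d" .
  moreover have "\<exists>D\<in>S. \<exists>w\<in>verts C \<inter> verts D. w \<noteq> v" if C: "C \<in> T" "v \<in> verts C" for C
  proof -
    have CC: "C \<in> through n v" using C T by auto
    have "\<exists>D\<in>S. E C \<inter> E D \<noteq> {}"
    \<comment> \<open>If \<open>C\<close> shared no edge at \<open>v\<close> with the family, it
      could be added, so by maximality it is a member. Then it shares no edge with itself either,
      contradicting its positive degree at \<open>v\<close>.\<close>
    proof (rule ccontr)
      assume *: "\<not> ?thesis"
      then have "insert C S \<in> F" using S(1) C CC by (auto simp: F_def)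
      then have "C \<in> S" using S(2)[of "insert C S"] by auto
      then have "E C = {}" using * by auto
      then show False using deg'[OF CC] min_degree_pos by simp
    qed
    then obtain D e where D: "D \<in> S" "e \<in> edges C" "e \<in> edges D" "v \<in> e" by (auto simp: E_def)
    have "simple_graph C" "simple_graph D"
      using CC ST(2) D(1) by (blast intro: copies_simple)+
    then have e: "e \<subseteq> verts C" "e \<subseteq> verts D" "card e = 2"
      using D(2,3) by (simp_all add: simple_graph_def)
    then obtain w where "w \<in> e" "w \<noteq> v"
      using D(4) by (auto simp: card_2_iff)
    then show ?thesis using D(1) e by auto
  qed
  ultimately show ?thesis using that ST by blast
qed

end

section \<open>Probability bounds for fixed \<open>n\<close>\<close>

lemma random_graph_eq:
  "random_graph H n p = map_pmf (\<lambda>f. ({1..n}, \<Union>C\<in>{C \<in> copies H n. f C}. edges C))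
     (Pi_pmf (copies H n) False (\<lambda>_. bernoulli_pmf p))"
  by (simp add: random_graph_def random_copies_def pmf.map_comp o_def)

lemma random_multigraph_eq:
  "random_multigraph H n p =
     map_pmf (\<lambda>f. ({1..n}, \<Sum>C\<in>{C \<in> copies H n. f C}. mset_set (edges C)))
     (Pi_pmf (copies H n) False (\<lambda>_. bernoulli_pmf p))"
  by (simp add: random_multigraph_def random_copies_def pmf.map_comp o_def)

section \<open>First moment bound for low degrees, above the threshold\<close>

lemma sum_subsets_card_less:
  fixes g :: "nat \<Rightarrow> real"
  assumes "finite A" and nonneg: "\<And>j. g j \<ge> 0"
  shows "(\<Sum>S | S \<subseteq> A \<and> card S < k. g (card S)) \<le> (\<Sum>j<k. real (card A) ^ j * g j)"
proof -
  have "(\<Sum>S | S \<subseteq> A \<and> card S < k. g (card S)) =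
      (\<Sum>j<k. \<Sum>S | S \<in> {S. S \<subseteq> A \<and> card S < k} \<and> card S = j. g (card S))"
    using assms(1) by (intro sum.group[symmetric]) auto
  also have "\<dots> = (\<Sum>j<k. real (card A choose j) * g j)"
  proof (rule sum.cong[OF refl])
    fix j assume "j \<in> {..<k}"
    then have "{S. S \<in> {S. S \<subseteq> A \<and> card S < k} \<and> card S = j} = {S. S \<subseteq> A \<and> card S = j}" by auto
    then show "(\<Sum>S | S \<in> {S. S \<subseteq> A \<and> card S < k} \<and> card S = j. g (card S)) =
        real (card A choose j) * g j"
      using n_subsets[OF assms(1), of j] by simp
  qed
  also have "\<dots> \<le> (\<Sum>j<k. real (card A) ^ j * g j)"
  proof (intro sum_mono mult_right_mono nonneg)
    fix j
    have "card A choose j \<le> card A ^ j"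
      by (cases "j \<le> card A") (auto simp: binomial_le_pow binomial_eq_0)
    then show "real (card A choose j) \<le> real (card A) ^ j"
      by (metis of_nat_le_iff of_nat_power)
  qed
  finally show ?thesis .
qed

context nonisolated_graph
begin

abbreviation selection :: "nat \<Rightarrow> real \<Rightarrow> (nat ugraph \<Rightarrow> bool) pmf" where
  "selection n p \<equiv> Pi_pmf (copies H n) False (\<lambda>_. bernoulli_pmf p)"

lemma codegree_real:
  assumes "u \<in> {1..n}" "v \<in> {1..n}" "u \<noteq> v"
  shows "real (codegree n u v) = real (h - 1) * real (m1 H n) / real (n - 1)"
proof -
  have "n - 1 > 0" using assms by auto
  moreover have "real (n - 1) * real (codegree n u v) = real (h - 1) * real (m1 H n)"
    using codegree_eq[OF assms] by (metis of_nat_mult)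
  ultimately show ?thesis by (simp add: field_simps)
qed

text \<open>Union bound over the vertices \<open>w\<close> of \<open>D\<close> other than
  \<open>v\<close>: each contributes one codegree, of order \<open>m1 / n\<close>.\<close>

lemma card_touching_le:
  assumes "v \<in> {1..n}" "D \<in> copies H n"
  shows "real (card {C \<in> through n v. \<exists>w\<in>verts C \<inter> verts D. w \<noteq> v}) \<le>
    real h * (real h * real (m1 H n) / real (n - 1))"
proof -
  have "{C \<in> through n v. \<exists>w\<in>verts C \<inter> verts D. w \<noteq> v} \<subseteq>
      (\<Union>w\<in>verts D - {v}. through n v \<inter> through n w)" by blast
  moreover have fin: "finite (verts D)"
    by (rule finite_subset[OF verts_copies[OF assms(2)]]) simp
  ultimately have "card {C \<in> through n v. \<exists>w\<in>verts C \<inter> verts D. w \<noteq> v} \<le>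
      card (\<Union>w\<in>verts D - {v}. through n v \<inter> through n w)"
    using finite_copies by (intro card_mono) auto
  also have "\<dots> \<le> (\<Sum>w\<in>verts D - {v}. codegree n v w)"
    unfolding codegree_def using fin by (intro card_UN_le) auto
  finally have "real (card {C \<in> through n v. \<exists>w\<in>verts C \<inter> verts D. w \<noteq> v}) \<le>
      real (\<Sum>w\<in>verts D - {v}. codegree n v w)"
    by (rule of_nat_mono)
  also have "\<dots> = (\<Sum>w\<in>verts D - {v}. real (codegree n v w))"
    by (rule of_nat_sum)
  also have "\<dots> \<le> (\<Sum>w\<in>verts D - {v}. real h * real (m1 H n) / real (n - 1))"
  proof (rule sum_mono)
    fix w assume "w \<in> verts D - {v}"
    then have "w \<in> {1..n}" "v \<noteq> w" using verts_copies[OF assms(2)] by auto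
    then show "real (codegree n v w) \<le> real h * real (m1 H n) / real (n - 1)"
      using assms(1) by (subst codegree_real) (auto intro!: divide_right_mono mult_right_mono)
  qed
  also have "\<dots> = real (card (verts D - {v})) * (real h * real (m1 H n) / real (n - 1))" by simp
  also have "\<dots> \<le> real h * (real h * real (m1 H n) / real (n - 1))"
  proof (rule mult_right_mono)
    have "card (verts D - {v}) \<le> h"
      using card_mono[OF fin, of "verts D - {v}"] card_verts_copies[OF assms(2)] by auto
    then show "real (card (verts D - {v})) \<le> real h" by simp
  qed simp
  finally show ?thesis .
qed

text \<open>Union bound over the possible families \<open>S\<close> from
  \<open>low_degree_family\<close>. Here \<open>k\<close> is a strict bound on
  \<open>card S\<close>, so it will be instantiated with the successor of
  \<open>delta_d\<close>.\<close>

lemma prob_low_degree_le: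
  fixes n d k :: nat and p :: real
  assumes v: "v \<in> {1..n}" and p: "0 \<le> p" "p \<le> 1"
    and k: "\<And>j. min_degree H * j < d \<Longrightarrow> j < k"
  defines "a \<equiv> p * real (m1 H n)"
  shows "measure_pmf.prob (selection n p)
      {f. vdegree ({1..n}, \<Union>C\<in>{C \<in> copies H n. f C}. edges C) v < d} \<le>
    (\<Sum>j<k. a ^ j) * exp (- a + real k * real h * real h * a / real (n - 1))"
proof -
  define c where "c = real h * (real h * real (m1 H n) / real (n - 1))"
  have c0: "c \<ge> 0" by (simp add: c_def)
  \<comment> \<open>Copies through \<open>v\<close> that meet the members of \<open>S\<close> only
    in \<open>v\<close>. If \<open>S\<close> is the family found for a selection, none of them is
    selected.\<close>
  define W where "W = (\<lambda>S :: nat ugraph set. {C \<in> through n v. \<forall>D\<in>S. \<forall>w\<in>verts C \<inter> verts D. w = v})"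
  define F where "F = {S. S \<subseteq> through n v \<and> card S < k}"
  have finW: "finite (W S)" for S using finite_copies by (simp add: W_def)
  have finF: "finite F"
    by (rule finite_subset[of _ "Pow (through n v)"]) (auto simp: F_def finite_copies)
  have card_W: "real (card (W S)) \<ge> real (m1 H n) - real k * c" if "S \<in> F" for S
  proof -
    have S: "S \<subseteq> through n v" "card S < k"
      using that by (auto simp: F_def)
    then have finS: "finite S"
      by (rule_tac finite_subset[of S "through n v"]) (use finite_copies in auto)
    let ?B = "\<Union>D\<in>S. {C \<in> through n v. \<exists>w\<in>verts C \<inter> verts D. w \<noteq> v}"
    have "through n v \<subseteq> W S \<union> ?B" by (auto simp: W_def)
    then have "card (through n v) \<le> card (W S \<union> ?B)"
      using finite_copies finW finS by (intro card_mono) auto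
    also have "\<dots> \<le> card (W S) + card ?B" by (rule card_Un_le)
    finally have "real (m1 H n) \<le> real (card (W S)) + real (card ?B)"
      unfolding card_through[OF v] by linarith
    also have "real (card ?B) \<le> real (\<Sum>D\<in>S. card {C \<in> through n v. \<exists>w\<in>verts C \<inter> verts D. w \<noteq> v})"
      using card_UN_le[OF finS] by (intro of_nat_mono)
    also have "\<dots> \<le> (\<Sum>D\<in>S. c)"
      unfolding of_nat_sum c_def using S(1) by (intro sum_mono card_touching_le[OF v]) auto
    also have "\<dots> \<le> real k * c" using S(2) c0 by (auto intro!: mult_right_mono)
    finally show ?thesis by simp
  qed
  define r where "r = exp (- (p * (real (m1 H n) - real k * c)))"
  have prob_S: "measure_pmf.prob (selection n p) {f. {C \<in> W S \<union> S. f C} = S} \<le> p ^ card S * r"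
    if "S \<in> F" for S
  proof -
    have S: "S \<subseteq> through n v" using that by (auto simp: F_def)
    \<comment> \<open>A common element would meet itself only in \<open>v\<close> and so have a
      single vertex, whereas \<open>h \<ge> 2\<close>.\<close>
    have "W S \<inter> S = {}"
    proof (rule ccontr)
      assume "W S \<inter> S \<noteq> {}"
      then obtain C where C: "C \<in> W S" "C \<in> S" by blast
      then have "verts C \<subseteq> {v}" by (auto simp: W_def)
      then have "card (verts C) \<le> card {v}" by (intro card_mono) auto
      moreover have "card (verts C) = h" using C(2) S by (blast intro: card_verts_copies)
      ultimately show False using h_ge_2 by simp
    qed
    then have WS: "W S \<union> S - S = W S" by blast
    have "measure_pmf.prob (selection n p) {f. {C \<in> W S \<union> S. f C} = S} =
        p ^ card S * (1 - p) ^ card (W S \<union> S - S)"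
      using p S finite_copies by (intro prob_Pi_bernoulli_pmf_eq) (auto simp: W_def)
    also have "(1 - p) ^ card (W S \<union> S - S) \<le> exp (- p) ^ card (W S)"
      unfolding WS using p exp_ge_add_one_self[of "- p"] by (intro power_mono) auto
    also have "\<dots> = exp (- (p * real (card (W S))))"
      by (simp add: exp_of_nat_mult[symmetric] mult_ac)
    also have "\<dots> \<le> r"
      unfolding r_def using card_W[OF that] p by (auto intro: mult_left_mono)
    finally show ?thesis using p by (simp add: mult_left_mono)
  qed
  have "{f. vdegree ({1..n}, \<Union>C\<in>{C \<in> copies H n. f C}. edges C) v < d} \<subseteq>
      (\<Union>S\<in>F. {f. {C \<in> W S \<union> S. f C} = S})"
  proof
    fix f assume "f \<in> {f. vdegree ({1..n}, \<Union>C\<in>{C \<in> copies H n. f C}. edges C) v < d}"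
    then have "vdegree ({1..n}, \<Union>C\<in>{C \<in> copies H n. f C}. edges C) v < d" by simp
    then obtain S where S: "S \<subseteq> {C \<in> copies H n. f C}" "S \<subseteq> through n v" "min_degree H * card S < d"
      "\<And>C. C \<in> {C \<in> copies H n. f C} \<Longrightarrow> v \<in> verts C \<Longrightarrow> \<exists>D\<in>S. \<exists>w\<in>verts C \<inter> verts D. w \<noteq> v"
      by (rule low_degree_family[rotated]) auto
    have "S \<in> F" using S(2,3) k by (simp add: F_def)
    \<comment> \<open>The members of \<open>S\<close> are selected, and a selected copy in
      \<open>W S\<close> would have to meet some member outside \<open>v\<close>.\<close>
    moreover have "{C \<in> W S \<union> S. f C} = S"
      using S(1) S(4) unfolding W_def by blast
    ultimately show "f \<in> (\<Union>S\<in>F. {f. {C \<in> W S \<union> S. f C} = S})" by blast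
  qed
  then have "measure_pmf.prob (selection n p)
      {f. vdegree ({1..n}, \<Union>C\<in>{C \<in> copies H n. f C}. edges C) v < d} \<le>
      measure_pmf.prob (selection n p) (\<Union>S\<in>F. {f. {C \<in> W S \<union> S. f C} = S})"
    by (intro measure_pmf.finite_measure_mono) auto
  also have "\<dots> \<le> (\<Sum>S\<in>F. measure_pmf.prob (selection n p) {f. {C \<in> W S \<union> S. f C} = S})"
    using finF by (intro measure_pmf.finite_measure_subadditive_finite) auto
  also have "\<dots> \<le> (\<Sum>S\<in>F. p ^ card S * r)"
    by (intro sum_mono prob_S)
  also have "\<dots> \<le> (\<Sum>j<k. real (card (through n v)) ^ j * (p ^ j * r))"
    unfolding F_def using finite_copies p
    by (intro sum_subsets_card_less) (auto simp: r_def)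
  also have "\<dots> = (\<Sum>j<k. a ^ j) * r"
    unfolding card_through[OF v] by (simp add: a_def power_mult_distrib sum_distrib_left mult_ac)
  also have "r = exp (- a + real k * real h * real h * a / real (n - 1))"
    by (simp add: r_def a_def c_def algebra_simps)
  finally show ?thesis .
qed

lemma prob_min_degree_less_le:
  fixes n d k :: nat and p :: real
  assumes n: "n \<ge> 1" and p: "0 \<le> p" "p \<le> 1"
    and k: "\<And>j. min_degree H * j < d \<Longrightarrow> j < k"
  defines "a \<equiv> p * real (m1 H n)"
  shows "measure_pmf.prob (random_graph H n p) {G. min_degree G < d} \<le>
    real n * ((\<Sum>j<k. a ^ j) * exp (- a + real k * real h * real h * a / real (n - 1)))"
proof -
  let ?E = "\<lambda>v. {f. vdegree ({1..n}, \<Union>C\<in>{C \<in> copies H n. f C}. edges C) v < d}"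
  have "measure_pmf.prob (random_graph H n p) {G. min_degree G < d} =
      measure_pmf.prob (selection n p) (\<Union>v\<in>{1..n}. ?E v)"
    unfolding random_graph_eq measure_map_pmf vimage_def mem_Collect_eq min_degree_less_iff[OF n]
    by (intro arg_cong[of _ _ "measure_pmf.prob _"]) blast
  also have "\<dots> \<le> (\<Sum>v\<in>{1..n}. measure_pmf.prob (selection n p) (?E v))"
    by (intro measure_pmf.finite_measure_subadditive_finite) auto
  also have "\<dots> \<le> (\<Sum>v\<in>{1..n}. (\<Sum>j<k. a ^ j) * exp (- a + real k * real h * real h * a / real (n - 1)))"
    unfolding a_def using p k by (intro sum_mono prob_low_degree_le)
  finally show ?thesis
    by (simp only: sum_constant card_atLeastAtMost Suc_eq_plus1 add_diff_cancel_right')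
qed

section \<open>Second moment bound for low degrees, below the threshold\<close>

text \<open>
  Loosening \<open>card = k\<close> to \<open>card \<le> k\<close> makes this event decreasing in \<open>W\<close>, so that
  discarding the copies through both of two vertices yields independent events without a case
  analysis of how the two witnessing families overlap.
\<close>

definition few_light :: "nat \<Rightarrow> nat \<Rightarrow> nat ugraph set \<Rightarrow> nat \<Rightarrow> (nat ugraph \<Rightarrow> bool) set" where
  "few_light n k W v = {f. {C \<in> W. f C} \<subseteq> light n v \<and> card {C \<in> W. f C} \<le> k}"

lemma few_light_antimono:
  assumes "W \<subseteq> W'" "W' \<subseteq> copies H n"
  shows "few_light n k W' v \<subseteq> few_light n k W v"
proof
  fix f assume f: "f \<in> few_light n k W' v"
  have "card {C \<in> W. f C} \<le> card {C \<in> W'. f C}"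
    using assms finite_subset[OF assms(2) finite_copies] by (intro card_mono) auto
  then show "f \<in> few_light n k W v"
    using f assms(1) unfolding few_light_def by auto
qed

lemma multi_vdegree_few_light:
  assumes "f \<in> few_light n k (through n v) v" "min_degree H * k < d"
  shows "multi_vdegree ({1..n}, \<Sum>C\<in>{C \<in> copies H n. f C}. mset_set (edges C)) v < d"
proof -
  let ?T = "{C \<in> copies H n. f C}"
  have "multi_vdegree ({1..n}, \<Sum>C\<in>?T. mset_set (edges C)) v = (\<Sum>C\<in>?T. vdegree C v)"
    using finite_copies by (intro multi_vdegree_sum_simple) (auto intro: copies_simple)
  also have "\<dots> = (\<Sum>C\<in>{C \<in> through n v. f C}. vdegree C v)"
  proof (intro sum.mono_neutral_right ballI)
    fix C assume "C \<in> ?T - {C \<in> through n v. f C}"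
    then have "simple_graph C" "v \<notin> verts C" by (blast intro: copies_simple)+
    then show "vdegree C v = 0" by (rule vdegree_eq_0)
  qed (use finite_copies in auto)
  also have "\<dots> = (\<Sum>C\<in>{C \<in> through n v. f C}. min_degree H)"
    using assms(1) by (intro sum.cong refl) (auto simp: few_light_def light_def)
  also have "\<dots> \<le> min_degree H * k"
    using assms(1) by (simp add: few_light_def)
  finally show ?thesis using assms(2) by simp
qed

text \<open>Only selections with exactly \<open>k\<close> copies through \<open>v\<close>, all
  light, are counted. The events for different \<open>k\<close>-sets are disjoint, so their
  probabilities add.\<close>

lemma prob_few_light_ge:
  assumes v: "v \<in> {1..n}" and p: "0 \<le> p" "p \<le> 1"
  shows "measure_pmf.prob (selection n p) (few_light n k (through n v) v) \<ge>
    real (card (light n v) choose k) * p ^ k * (1 - p) ^ m1 H n"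
proof -
  let ?F = "{S. S \<subseteq> light n v \<and> card S = k}"
  let ?E = "\<lambda>S. {f. {C \<in> through n v. f C} = S}"
  have light: "light n v \<subseteq> through n v" by (auto simp: light_def)
  have fl: "finite (light n v)" using light finite_copies by (auto intro: finite_subset)
  have "real (card (light n v) choose k) * p ^ k * (1 - p) ^ m1 H n =
      (\<Sum>S\<in>?F. p ^ k * (1 - p) ^ m1 H n)"
    using n_subsets[OF fl, of k] by simp
  also have "\<dots> \<le> (\<Sum>S\<in>?F. measure_pmf.prob (selection n p) (?E S))"
  proof (rule sum_mono)
    fix S assume S: "S \<in> ?F"
    have "measure_pmf.prob (selection n p) (?E S) = p ^ card S * (1 - p) ^ card (through n v - S)"
      using S light p finite_copies by (intro prob_Pi_bernoulli_pmf_eq) auto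
    moreover have "card (through n v - S) \<le> m1 H n"
      unfolding card_through[OF v, symmetric] using finite_copies by (intro card_mono) auto
    ultimately show "p ^ k * (1 - p) ^ m1 H n \<le> measure_pmf.prob (selection n p) (?E S)"
      using S p by (auto intro!: mult_left_mono power_decreasing)
  qed
  also have "\<dots> = measure_pmf.prob (selection n p) (\<Union>S\<in>?F. ?E S)"
    using fl by (intro measure_pmf.finite_measure_finite_Union[symmetric])
      (auto simp: disjoint_family_on_def)
  also have "\<dots> \<le> measure_pmf.prob (selection n p) (few_light n k (through n v) v)"
    by (intro measure_pmf.finite_measure_mono) (auto simp: few_light_def)
  finally show ?thesis .
qed

text \<open>The event for \<open>W - B\<close> and the event that nothing in \<open>B\<close> is
  selected are independent, and together they imply the event for \<open>W\<close>. So discarding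
  \<open>B\<close> costs at most a factor \<open>(1 - p) ^ card B\<close>.\<close>

lemma prob_few_light_remove:
  assumes "W \<subseteq> copies H n" "B \<subseteq> W" and p: "0 \<le> p" "p \<le> 1"
  shows "measure_pmf.prob (selection n p) (few_light n k (W - B) v) * (1 - p) ^ card B \<le>
    measure_pmf.prob (selection n p) (few_light n k W v)"
proof -
  have BW: "B \<subseteq> copies H n" using assms by blast
  have "measure_pmf.prob (selection n p) {f. {C \<in> B. f C} = {}} = (1 - p) ^ card B"
    using prob_Pi_bernoulli_pmf_eq[OF finite_copies BW, of "{}" p] p by simp
  moreover have "measure_pmf.prob (selection n p) {f. f \<in> few_light n k (W - B) v \<and> {C \<in> B. f C} = {}} =
      measure_pmf.prob (selection n p) {f. f \<in> few_light n k (W - B) v} *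
      measure_pmf.prob (selection n p) {f. {C \<in> B. f C} = {}}"
  proof (rule prob_Pi_pmf_indep[OF finite_copies])
    show "W - B \<subseteq> copies H n" using assms(1) by blast
    show "f \<in> few_light n k (W - B) v \<longleftrightarrow> g \<in> few_light n k (W - B) v"
      if "\<And>C. C \<in> W - B \<Longrightarrow> f C = g C" for f g
    proof -
      have "{C \<in> W - B. f C} = {C \<in> W - B. g C}" using that by blast
      then show ?thesis by (simp add: few_light_def)
    qed
    show "{C \<in> B. f C} = {} \<longleftrightarrow> {C \<in> B. g C} = {}"
      if "\<And>C. C \<in> copies H n - (W - B) \<Longrightarrow> f C = g C" for f g
      using that BW by blast
  qed
  ultimately have "measure_pmf.prob (selection n p) (few_light n k (W - B) v) * (1 - p) ^ card B =
      measure_pmf.prob (selection n p) {f. f \<in> few_light n k (W - B) v \<and> {C \<in> B. f C} = {}}"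
    by simp
  also have "\<dots> \<le> measure_pmf.prob (selection n p) (few_light n k W v)"
  proof (intro measure_pmf.finite_measure_mono subsetI)
    fix f assume f: "f \<in> {f. f \<in> few_light n k (W - B) v \<and> {C \<in> B. f C} = {}}"
    then have "{C \<in> W. f C} = {C \<in> W - B. f C}" by blast
    then show "f \<in> few_light n k W v" using f by (simp add: few_light_def)
  qed simp
  finally show ?thesis .
qed

text \<open>Discarding the copies through both vertices enlarges both events and makes them depend
  on disjoint sets of copies. Restoring the shared copies costs one factor per vertex, hence the
  exponent \<open>2 * codegree n u v\<close>.\<close>

lemma prob_few_light_pair:
  assumes uv: "u \<in> {1..n}" "v \<in> {1..n}" "u \<noteq> v" and p: "0 \<le> p" "p < 1"
  shows "measure_pmf.prob (selection n p)
      (few_light n k (through n u) u \<inter> few_light n k (through n v) v) \<le>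
    1 / (1 - p) ^ (2 * codegree n u v) *
      (measure_pmf.prob (selection n p) (few_light n k (through n u) u) *
       measure_pmf.prob (selection n p) (few_light n k (through n v) v))"
proof -
  let ?B = "through n u \<inter> through n v"
  let ?P = "measure_pmf.prob (selection n p)"
  let ?A = "\<lambda>u. few_light n k (through n u - ?B) u"
  let ?q = "(1 - p) ^ codegree n u v"
  have q: "?q > 0" using p by simp
  have dep: "f \<in> ?A w \<longleftrightarrow> g \<in> ?A w" if "\<And>C. C \<in> through n w - ?B \<Longrightarrow> f C = g C" for f g w
  proof -
    have "{C \<in> through n w - ?B. f C} = {C \<in> through n w - ?B. g C}" using that by blast
    then show ?thesis by (simp add: few_light_def)
  qed
  have le: "?P (?A w) * ?q \<le> ?P (few_light n k (through n w) w)" if "w \<in> {u, v}" for w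
    unfolding codegree_def using p that by (intro prob_few_light_remove) auto
  have "?P (few_light n k (through n u) u \<inter> few_light n k (through n v) v) \<le>
      ?P {f. f \<in> ?A u \<and> f \<in> ?A v}"
  proof (intro measure_pmf.finite_measure_mono subsetI)
    fix f assume "f \<in> few_light n k (through n u) u \<inter> few_light n k (through n v) v"
    then show "f \<in> {f. f \<in> ?A u \<and> f \<in> ?A v}"
      using few_light_antimono[of "through n u - ?B" "through n u" n k u]
        few_light_antimono[of "through n v - ?B" "through n v" n k v] by blast
  qed simp
  also have "\<dots> = ?P {f. f \<in> ?A u} * ?P {f. f \<in> ?A v}"
    using finite_copies dep
    by (intro prob_Pi_pmf_indep[where J = "through n u - ?B"]) blast+
  also have "\<dots> \<le> (?P (few_light n k (through n u) u) / ?q) * (?P (few_light n k (through n v) v) / ?q)"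
    using le q by (intro mult_mono) (auto simp: pos_le_divide_eq)
  also have "\<dots> = 1 / (1 - p) ^ (2 * codegree n u v) *
      (?P (few_light n k (through n u) u) * ?P (few_light n k (through n v) v))"
    by (simp add: mult_2 power_add)
  finally show ?thesis .
qed

text \<open>The second moment method for the events \<open>few_light\<close>, each of which forces
  degree below \<open>d\<close>. \<open>L\<close> bounds each probability from below, and
  \<open>K\<close> bounds the correlation of each pair. The second condition on \<open>n\<close>
  guarantees at least \<open>k\<close> light copies at every vertex.\<close>

lemma prob_multi_min_degree_ge_le:
  fixes n d k :: nat and p :: real
  assumes n: "n \<ge> h" "real n - 1 \<ge> real k * (real h)\<^sup>2" and p: "0 < p" "p \<le> 1 / 2"
    and k: "min_degree H * k < d"
  defines "a \<equiv> p * real (m1 H n)"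
  shows "measure_pmf.prob (random_multigraph H n p) {G. \<not> multi_min_degree G < d} \<le>
    1 / (real n * ((a / (real h * real k)) ^ k * exp (- a - 2 * real h * a\<^sup>2 / (real n - 1)))) +
    (exp (4 * real h * a / (real n - 1)) - 1)"
proof -
  let ?P = "measure_pmf.prob (selection n p)"
  let ?E = "\<lambda>v. few_light n k (through n v) v"
  let ?m = "real (m1 H n)"
  define L where "L = (a / (real h * real k)) ^ k * exp (- a - 2 * real h * a\<^sup>2 / (real n - 1))"
  define K where "K = exp (4 * real h * a / (real n - 1))"
  have h: "h \<ge> 2" by (rule h_ge_2)
  have n1: "real n - 1 > 0" "n \<ge> 1" using n h by auto
  have "real (n - 1) \<le> real ((h - 1) * m1 H n)" using m1_ge[OF n(1)] by (rule of_nat_mono)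
  also have "\<dots> \<le> real h * ?m"
    unfolding of_nat_mult by (intro mult_right_mono) auto
  finally have nm: "real n - 1 \<le> real h * ?m" using n1 by (simp add: of_nat_diff)
  then have m_pos: "?m > 0" using n1(1) h by (metis less_le_trans zero_less_mult_pos of_nat_0_less_iff
      less_le_trans pos2)
  have a_pos: "a > 0" using p m_pos by (simp add: a_def)
  \<comment> \<open>For \<open>k = 0\<close> the quotient in \<open>L\<close> is a division by 0,
    but its power with exponent 0 is 1.\<close>
  have L_pos: "L > 0"
    using a_pos h by (cases "k = 0") (auto simp: L_def)
  have PE: "L \<le> ?P (?E v)" if v: "v \<in> {1..n}" for v
  proof -
    let ?l = "card (light n v)"
    have ml: "?m \<le> real h * real ?l"
      using card_light[OF v] by (metis of_nat_le_iff of_nat_mult)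
    \<comment> \<open>Chains \<open>k * h\<^sup>2 \<le> n - 1 \<le> h * m1\<close> with
      \<open>m1 \<le> h * card (light n v)\<close>.\<close>
    have "real k * (real h)\<^sup>2 \<le> real h * (real h * real ?l)"
      using n(2) nm mult_left_mono[OF ml, of "real h"] by linarith
    then have "(real h)\<^sup>2 * real k \<le> (real h)\<^sup>2 * real ?l"
      by (simp add: power2_eq_square mult_ac)
    then have kl: "k \<le> ?l" using h by (simp del: of_nat_power)
    \<comment> \<open>The second-order error \<open>2 * p\<^sup>2 * m1\<close> equals
      \<open>2 * p * a\<close>. Since \<open>n - 1 \<le> h * m1\<close>, it is bounded by an
      expression in \<open>a\<close> and \<open>n\<close> alone.\<close>
    have "2 * real h * a\<^sup>2 / (real n - 1) \<ge> 2 * p * a"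
    proof -
      have "(2 * p * a) * (real n - 1) \<le> (2 * p * a) * (real h * ?m)"
        using nm p a_pos by (intro mult_left_mono) auto
      also have "\<dots> = 2 * real h * a\<^sup>2" by (simp add: a_def power2_eq_square)
      finally show ?thesis using n1 by (simp add: pos_le_divide_eq)
    qed
    then have "exp (- a - 2 * real h * a\<^sup>2 / (real n - 1)) \<le> exp (- (?m * (p + 2 * p\<^sup>2)))"
      by (simp add: a_def algebra_simps power2_eq_square)
    also have "\<dots> \<le> (1 - p) ^ m1 H n"
      using p by (intro one_minus_power_ge) auto
    finally have e: "exp (- a - 2 * real h * a\<^sup>2 / (real n - 1)) \<le> (1 - p) ^ m1 H n" .
    have "(a / (real h * real k)) ^ k \<le> (real ?l / real k * p) ^ k"
    proof (rule power_mono)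
      have "a \<le> real h * real ?l * p" using ml p by (simp add: a_def mult.commute)
      then have "a / (real h * real k) \<le> (real h * real ?l * p) / (real h * real k)"
        by (intro divide_right_mono) auto
      then show "a / (real h * real k) \<le> real ?l / real k * p" using h by simp
    qed (use a_pos in auto)
    also have "\<dots> \<le> real (?l choose k) * p ^ k"
      unfolding power_mult_distrib using kl p
      by (intro mult_right_mono binomial_ge_n_over_k_pow_k) auto
    finally have "L \<le> real (?l choose k) * p ^ k * (1 - p) ^ m1 H n"
      unfolding L_def using e p by (intro mult_mono) auto
    also have "\<dots> \<le> ?P (?E v)" using v p by (intro prob_few_light_ge) auto
    finally show ?thesis .
  qed
  have sum_ge: "(\<Sum>v\<in>{1..n}. ?P (?E v)) \<ge> real n * L"
    using sum_mono[of "{1..n}" "\<lambda>_. L" "\<lambda>v. ?P (?E v)"] PE by simp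
  have nL: "real n * L > 0" using L_pos n1 by simp
  have K: "1 / (1 - p) ^ (2 * codegree n u v) \<le> K"
    if uv: "u \<in> {1..n}" "v \<in> {1..n}" "u \<noteq> v" for u v
  proof -
    let ?c = "codegree n u v"
    have "real ?c * (real n - 1) = real (h - 1) * ?m"
      using codegree_real[OF uv] n1 by (simp add: of_nat_diff field_simps)
    also have "\<dots> \<le> real h * ?m" by (intro mult_right_mono) auto
    finally have c: "real ?c \<le> real h * ?m / (real n - 1)" using n1 by (simp add: pos_le_divide_eq)
    have "1 / (1 - p) ^ (2 * ?c) \<le> 1 / exp (- (real (2 * ?c) * (p + 2 * p\<^sup>2)))"
      using one_minus_power_ge[of p "2 * ?c"] p by (intro divide_left_mono) auto
    also have "\<dots> = exp (real (2 * ?c) * (p + 2 * p\<^sup>2))" 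
      by (simp only: exp_minus inverse_eq_divide[symmetric] inverse_inverse_eq)
    \<comment> \<open>Since \<open>p \<le> 1 / 2\<close>, the term \<open>2 * p\<^sup>2\<close> is
      at most \<open>p\<close>.\<close>
    also have "real (2 * ?c) * (p + 2 * p\<^sup>2) \<le> real (2 * ?c) * (2 * p)"
      using p by (intro mult_left_mono) (auto simp: power2_eq_square)
    also have "\<dots> = 4 * p * real ?c" by simp
    also have "\<dots> \<le> 4 * p * (real h * ?m / (real n - 1))" using c p by (intro mult_left_mono) auto
    also have "\<dots> = 4 * real h * a / (real n - 1)" by (simp add: a_def)
    finally show ?thesis by (simp add: K_def)
  qed
  have fin: "finite (set_pmf (selection n p))"
    by (rule finite_subset[OF set_Pi_pmf_subset' finite_PiE_dflt])
      (auto simp: finite_copies intro: finite_subset[OF subset_UNIV])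
  have "measure_pmf.prob (random_multigraph H n p) {G. \<not> multi_min_degree G < d} \<le>
      ?P {f. \<forall>v\<in>{1..n}. f \<notin> ?E v}"
    unfolding random_multigraph_eq measure_map_pmf vimage_def mem_Collect_eq
      multi_min_degree_less_iff[OF n1(2)]
    using multi_vdegree_few_light[OF _ k] by (intro measure_pmf.finite_measure_mono) (blast, simp)
  also have "\<dots> \<le> 1 / (\<Sum>v\<in>{1..n}. ?P (?E v)) + (K - 1)"
  proof (rule measure_pmf_second_moment)
    show "1 \<le> K" using a_pos n1 by (simp add: K_def)
    show "(\<Sum>v\<in>{1..n}. ?P (?E v)) > 0" using sum_ge nL by linarith
    fix u v assume uv: "u \<in> {1..n}" "v \<in> {1..n}" "u \<noteq> v"
    have "?P (?E u \<inter> ?E v) \<le> 1 / (1 - p) ^ (2 * codegree n u v) * (?P (?E u) * ?P (?E v))"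
      using uv p by (intro prob_few_light_pair) auto
    also have "\<dots> \<le> K * (?P (?E u) * ?P (?E v))"
      using K[OF uv] by (intro mult_right_mono) auto
    finally show "?P (?E u \<inter> ?E v) \<le> K * (?P (?E u) * ?P (?E v))" .
  qed (use fin in auto)
  also have "1 / (\<Sum>v\<in>{1..n}. ?P (?E v)) \<le> 1 / (real n * L)"
    using sum_ge nL by (intro divide_left_mono) auto
  finally show ?thesis by (simp add: L_def K_def)
qed

end

section \<open>Asymptotics\<close>

text \<open>The perturbation \<open>y\<close> is absorbed as one more \<open>ln (ln n)\<close>, and
  \<open>k + 1\<close> of these are eventually at most \<open>ln n / 2\<close>.\<close>

lemma eventually_ln_perturbed:
  fixes y :: "nat \<Rightarrow> real" and k :: nat
  assumes "y \<in> o(\<lambda>n. ln (ln (real n)))"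
  shows "eventually (\<lambda>n. ln (real n) / 2 \<le> ln (real n) + (real k * ln (ln (real n)) + y n) \<and>
    ln (real n) + (real k * ln (ln (real n)) + y n) \<le> 2 * ln (real n)) sequentially"
proof -
  have y: "eventually (\<lambda>n. norm (y n) \<le> 1 * norm (ln (ln (real n)))) sequentially"
    by (rule landau_o.smallD[OF assms]) simp
  have "(\<lambda>n. ln (ln (real n))) \<in> o(\<lambda>n. ln (real n))" by real_asymp
  then have l: "eventually (\<lambda>n. norm (ln (ln (real n))) \<le> 1 / (2 * (real k + 1)) * norm (ln (real n))) sequentially"
    by (rule landau_o.smallD) simp
  have "eventually (\<lambda>n. ln (real n) > 0) sequentially" by real_asymp
  with y l show ?thesis
  proof eventually_elim
    case (elim n)
    have "\<bar>real k * ln (ln (real n)) + y n\<bar> \<le> real k * \<bar>ln (ln (real n))\<bar> + \<bar>y n\<bar>"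
      by (metis abs_mult abs_of_nat abs_triangle_ineq)
    also have "\<dots> \<le> (real k + 1) * \<bar>ln (ln (real n))\<bar>"
      using elim(1) by (simp add: algebra_simps)
    also have "\<dots> \<le> (real k + 1) * (1 / (2 * (real k + 1)) * ln (real n))"
      using elim by (intro mult_left_mono) auto
    also have "\<dots> = ln (real n) / 2" by (simp add: divide_simps)
    finally show ?case using elim(3) by linarith
  qed
qed

lemma eventually_div_le:
  fixes f :: "nat \<Rightarrow> real"
  assumes "(\<lambda>n. f n / (real n - 1)) \<longlonglongrightarrow> 0" "c > 0"
  shows "eventually (\<lambda>n. C * f n / (real n - 1) \<le> c) sequentially"
proof -
  have "(\<lambda>n. C * (f n / (real n - 1))) \<longlonglongrightarrow> C * 0"
    by (intro tendsto_intros assms)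
  then have "eventually (\<lambda>n. C * (f n / (real n - 1)) < c) sequentially"
    using assms(2) by (intro order_tendstoD) auto
  then show ?thesis by eventually_elim simp
qed

text \<open>This is where the shape of the threshold comes from: the \<open>k\<close> iterated
  logarithms cancel the factor \<open>ln n ^ k\<close>, which is the order of the number of families
  times \<open>p ^ k\<close>, and only \<open>y\<close> survives.\<close>

lemma exp_minus_ln_perturbed:
  assumes "ln (real n) > 0"
  shows "real n * exp (- (ln (real n) + (real k * ln (ln (real n)) + y))) * ln (real n) ^ k = exp (- y)"
proof -
  have n: "real n > 0" using assms by (cases n) auto
  have "exp (real k * ln (ln (real n))) = ln (real n) ^ k"
    using assms by (metis exp_ln exp_of_nat_mult)
  then have "exp (- (ln (real n) + (real k * ln (ln (real n)) + y))) = exp (- y) / (real n * ln (real n) ^ k)"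
    using n by (simp add: exp_add exp_minus exp_diff divide_simps)
  then show ?thesis using n assms by simp
qed

text \<open>The sum is at most \<open>k + 1\<close> times \<open>(2 * ln n) ^ k\<close>, and the
  correction in the exponent is eventually at most 1. What remains is a constant times
  \<open>exp (- y n)\<close>.\<close>

lemma first_moment_tendsto_0:
  fixes y :: "nat \<Rightarrow> real" and k :: nat
  assumes y: "y \<in> o(\<lambda>n. ln (ln (real n)))" and top: "filterlim y at_top sequentially"
    and "C \<ge> 0"
  defines "a \<equiv> \<lambda>n. ln (real n) + (real k * ln (ln (real n)) + y n)"
  shows "(\<lambda>n. real n * ((\<Sum>j<Suc k. a n ^ j) * exp (- a n + C * a n / real (n - 1)))) \<longlonglongrightarrow> 0"
proof (rule tendsto_sandwich)
  have lim: "(\<lambda>n. ln (real n) / (real n - 1)) \<longlonglongrightarrow> 0" by real_asymp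
  \<comment> \<open>The factor 2 comes from \<open>a n \<le> 2 * ln n\<close>.\<close>
  have ev: "eventually (\<lambda>n. 2 * C * ln (real n) / (real n - 1) \<le> 1) sequentially"
    by (rule eventually_div_le[OF lim]) simp
  have ln2: "eventually (\<lambda>n. ln (real n) > 2) sequentially" by real_asymp
  have n2: "eventually (\<lambda>n. n \<ge> 2) sequentially" by (rule eventually_ge_at_top)
  have bounds: "eventually (\<lambda>n. 1 \<le> a n \<and> a n \<le> 2 * ln (real n)) sequentially"
    using eventually_ln_perturbed[OF y, of k] ln2
    by eventually_elim (simp add: a_def)
  show "eventually (\<lambda>n. 0 \<le> real n * ((\<Sum>j<Suc k. a n ^ j) * exp (- a n + C * a n / real (n - 1)))) sequentially"
    using bounds by eventually_elim
      (auto simp del: sum.lessThan_Suc intro!: mult_nonneg_nonneg sum_nonneg)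
  show "eventually (\<lambda>n. real n * ((\<Sum>j<Suc k. a n ^ j) * exp (- a n + C * a n / real (n - 1))) \<le>
      real (Suc k) * 2 ^ k * exp 1 * exp (- y n)) sequentially"
    using bounds ev ln2 n2
  proof eventually_elim
    case (elim n)
    have "(\<Sum>j<Suc k. a n ^ j) \<le> (\<Sum>j<Suc k. (2 * ln (real n)) ^ k)"
    proof (rule sum_mono)
      fix j assume "j \<in> {..<Suc k}"
      then have "a n ^ j \<le> a n ^ k" using elim by (intro power_increasing) auto
      also have "\<dots> \<le> (2 * ln (real n)) ^ k" using elim by (intro power_mono) auto
      finally show "a n ^ j \<le> (2 * ln (real n)) ^ k" .
    qed
    then have s: "(\<Sum>j<Suc k. a n ^ j) \<le> real (Suc k) * 2 ^ k * ln (real n) ^ k"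
      by (simp add: power_mult_distrib mult.assoc)
    have "C * a n / (real n - 1) \<le> 2 * C * ln (real n) / (real n - 1)"
      using elim \<open>C \<ge> 0\<close> mult_left_mono[of "a n" "2 * ln (real n)" C]
      by (intro divide_right_mono) auto
    then have "C * a n / (real n - 1) \<le> 1" using elim(2) by linarith
    then have "C * a n / real (n - 1) \<le> 1" using elim(4) by (simp add: of_nat_diff del: divide_le_eq_1)
    then have e: "exp (- a n + C * a n / real (n - 1)) \<le> exp (- a n) * exp 1"
      by (simp flip: exp_add)
    have "real n * ((\<Sum>j<Suc k. a n ^ j) * exp (- a n + C * a n / real (n - 1))) \<le>
        real n * ((real (Suc k) * 2 ^ k * ln (real n) ^ k) * (exp (- a n) * exp 1))"
      using elim by (intro mult_left_mono mult_mono s e) auto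
    also have "\<dots> = real (Suc k) * 2 ^ k * exp 1 * (real n * exp (- a n) * ln (real n) ^ k)"
      by (simp only: mult_ac)
    also have "real n * exp (- a n) * ln (real n) ^ k = exp (- y n)"
      unfolding a_def using elim by (intro exp_minus_ln_perturbed) auto
    finally show ?case .
  qed
  have "((\<lambda>n. exp (- y n)) \<longlonglongrightarrow> 0)"
    by (rule filterlim_compose[OF exp_at_bot]) (use top in \<open>simp add: filterlim_uminus_at_bot\<close>)
  then have "(\<lambda>n. real (Suc k) * 2 ^ k * exp 1 * exp (- y n)) \<longlonglongrightarrow> real (Suc k) * 2 ^ k * exp 1 * 0"
    by (intro tendsto_intros)
  then show "(\<lambda>n. real (Suc k) * 2 ^ k * exp 1 * exp (- y n)) \<longlonglongrightarrow> 0" by simp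
qed simp

text \<open>The expected number of good vertices is at least a constant times
  \<open>exp (y n)\<close>, so its reciprocal vanishes. The correlation excess vanishes because
  \<open>a n / (n - 1)\<close> tends to 0.\<close>

lemma second_moment_tendsto_0:
  fixes y :: "nat \<Rightarrow> real" and k h :: nat
  assumes y: "y \<in> o(\<lambda>n. ln (ln (real n)))" and top: "filterlim y at_top sequentially"
    and h: "h \<ge> 1"
  defines "a \<equiv> \<lambda>n. ln (real n) + (real k * ln (ln (real n)) - y n)"
  shows "(\<lambda>n. 1 / (real n * ((a n / (real h * real k)) ^ k *
      exp (- a n - 2 * real h * (a n)\<^sup>2 / (real n - 1)))) +
    (exp (4 * real h * a n / (real n - 1)) - 1)) \<longlonglongrightarrow> 0"
proof -
  have lim: "(\<lambda>n. ln (real n) / (real n - 1)) \<longlonglongrightarrow> 0" by real_asymp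
  have lim2: "(\<lambda>n. (ln (real n))\<^sup>2 / (real n - 1)) \<longlonglongrightarrow> 0" by real_asymp
  \<comment> \<open>8 is the coefficient 2 times the square of the 2 in
    \<open>a n \<le> 2 * ln n\<close>.\<close>
  have ev: "eventually (\<lambda>n. 8 * real h * (ln (real n))\<^sup>2 / (real n - 1) \<le> 1) sequentially"
    by (rule eventually_div_le[OF lim2]) simp
  have ln2: "eventually (\<lambda>n. ln (real n) > 2) sequentially" by real_asymp
  have n2: "eventually (\<lambda>n. n \<ge> 2) sequentially" by (rule eventually_ge_at_top)
  have y': "(\<lambda>n. - y n) \<in> o(\<lambda>n. ln (ln (real n)))" using y by simp
  have bounds: "eventually (\<lambda>n. ln (real n) / 2 \<le> a n \<and> a n \<le> 2 * ln (real n)) sequentially"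
    using eventually_ln_perturbed[OF y', of k] by (simp add: a_def)
  let ?L = "\<lambda>n. real n * ((a n / (real h * real k)) ^ k * exp (- a n - 2 * real h * (a n)\<^sup>2 / (real n - 1)))"
  have "(\<lambda>n. 1 / ?L n) \<longlonglongrightarrow> 0"
  proof (rule tendsto_sandwich)
    show "eventually (\<lambda>n. 0 \<le> 1 / ?L n) sequentially"
      using bounds ln2 by eventually_elim auto
    \<comment> \<open>The constant left when \<open>ln n ^ k\<close> is pulled out of the power,
      using \<open>a n \<ge> ln n / 2\<close>; it is 1 for \<open>k = 0\<close>.\<close>
    define c where "c = (1 / (2 * (real h * real k))) ^ k"
    have c: "c > 0" using h by (cases "k = 0") (auto simp: c_def)
    show "eventually (\<lambda>n. 1 / ?L n \<le> exp 1 / c * exp (- y n)) sequentially"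
      using bounds ev ln2 n2
    proof eventually_elim
      case (elim n)
      have "(a n)\<^sup>2 \<le> (2 * ln (real n))\<^sup>2" using elim by (intro power_mono) auto
      then have "2 * real h * (a n)\<^sup>2 \<le> 2 * real h * (2 * ln (real n))\<^sup>2" by (intro mult_left_mono) auto
      then have "2 * real h * (a n)\<^sup>2 / (real n - 1) \<le> 8 * real h * (ln (real n))\<^sup>2 / (real n - 1)"
        using elim by (intro divide_right_mono) (auto simp: power_mult_distrib)
      then have "2 * real h * (a n)\<^sup>2 / (real n - 1) \<le> 1" using elim by linarith
      then have e: "exp (- a n) * exp (- 1) \<le> exp (- a n - 2 * real h * (a n)\<^sup>2 / (real n - 1))"
        by (simp flip: exp_add del: divide_le_eq_1)
      have "(ln (real n) / 2) / (real h * real k) \<le> a n / (real h * real k)"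
        using elim by (intro divide_right_mono) auto
      then have "((ln (real n) / 2) / (real h * real k)) ^ k \<le> (a n / (real h * real k)) ^ k"
        using elim by (intro power_mono) auto
      also have "((ln (real n) / 2) / (real h * real k)) ^ k = c * ln (real n) ^ k"
        unfolding c_def power_mult_distrib[symmetric] by (rule arg_cong[of _ _ "\<lambda>t. t ^ k"]) simp
      finally have q: "c * ln (real n) ^ k \<le> (a n / (real h * real k)) ^ k" .
      have "exp (y n) = real n * exp (- a n) * ln (real n) ^ k"
        using exp_minus_ln_perturbed[of n k "- y n"] elim by (simp add: a_def)
      then have "c * exp (y n) * exp (- 1) = real n * ((c * ln (real n) ^ k) * (exp (- a n) * exp (- 1)))"
        by (simp only: mult_ac)
      also have "\<dots> \<le> ?L n"
        using elim c by (intro mult_left_mono mult_mono q e) auto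
      finally have "c * exp (y n) * exp (- 1) \<le> ?L n" .
      then have "1 / ?L n \<le> 1 / (c * exp (y n) * exp (- 1))"
        using c by (intro frac_le) auto
      also have "\<dots> = exp 1 / c * exp (- y n)" by (simp add: exp_minus field_simps)
      finally show ?case .
    qed
    have "((\<lambda>n. exp (- y n)) \<longlonglongrightarrow> 0)"
      by (rule filterlim_compose[OF exp_at_bot]) (use top in \<open>simp add: filterlim_uminus_at_bot\<close>)
    then have "(\<lambda>n. exp 1 / c * exp (- y n)) \<longlonglongrightarrow> exp 1 / c * 0"
      by (intro tendsto_intros)
    then show "(\<lambda>n. exp 1 / c * exp (- y n)) \<longlonglongrightarrow> 0" by simp
  qed simp
  moreover have "(\<lambda>n. exp (4 * real h * a n / (real n - 1)) - 1) \<longlonglongrightarrow> 0"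
  proof -
    have "(\<lambda>n. a n / (real n - 1)) \<longlonglongrightarrow> 0"
    proof (rule tendsto_sandwich)
      show "eventually (\<lambda>n. 0 \<le> a n / (real n - 1)) sequentially"
        using bounds ln2 n2 by eventually_elim auto
      show "eventually (\<lambda>n. a n / (real n - 1) \<le> 2 * (ln (real n) / (real n - 1))) sequentially"
        using bounds n2 by eventually_elim (auto intro!: divide_right_mono)
      have "(\<lambda>n. 2 * (ln (real n) / (real n - 1))) \<longlonglongrightarrow> 2 * 0"
        by (intro tendsto_intros lim)
      then show "(\<lambda>n. 2 * (ln (real n) / (real n - 1))) \<longlonglongrightarrow> 0" by simp
    qed simp
    then have "(\<lambda>n. exp (4 * real h * (a n / (real n - 1))) - 1) \<longlonglongrightarrow> exp (4 * real h * 0) - 1"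
      by (intro tendsto_intros)
    then show ?thesis by simp
  qed
  ultimately show ?thesis by (intro tendsto_add_zero)
qed

section \<open>Inserting the threshold probabilities\<close>

context nonisolated_graph
begin

lemma ceiling_div_min_degree_pos:
  "d \<ge> 1 \<Longrightarrow> \<lceil>real d / real (min_degree H)\<rceil> > 0"
  using min_degree_pos by (simp add: less_ceiling_iff)

text \<open>\<open>delta_d H d\<close> is the largest \<open>j\<close> such that \<open>j\<close>
  copies of minimum degree stay below \<open>d\<close>. As \<open>d \<ge> 1\<close>, the ceiling is
  at least 1 and \<open>nat\<close> truncates nothing.\<close>

lemma min_degree_mult_less_iff:
  assumes "d \<ge> 1"
  shows "min_degree H * j < d \<longleftrightarrow> j < Suc (nat (delta_d H d))"
proof -
  have pos: "real (min_degree H) > 0" using min_degree_pos by simp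
  have "min_degree H * j < d \<longleftrightarrow> real (min_degree H) * real j < real d"
    by (metis of_nat_less_iff of_nat_mult)
  also have "\<dots> \<longleftrightarrow> real_of_int (int j) < real d / real (min_degree H)"
    using pos by (simp add: field_simps)
  also have "\<dots> \<longleftrightarrow> int j < \<lceil>real d / real (min_degree H)\<rceil>"
    by (simp add: less_ceiling_iff)
  also have "\<dots> \<longleftrightarrow> j < Suc (nat (delta_d H d))"
    using ceiling_div_min_degree_pos[OF assms] unfolding delta_d_def by linarith
  finally show ?thesis .
qed

lemma prob_multi_min_degree_less_le:
  assumes "n \<ge> 1"
  shows "measure_pmf.prob (random_multigraph H n p) {G. multi_min_degree G < d} \<le>
    measure_pmf.prob (random_graph H n p) {G. min_degree G < d}"
proof -
  have "vdegree ({1..n}, \<Union>C\<in>{C \<in> copies H n. f C}. edges C) v \<le>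
      multi_vdegree ({1..n}, \<Sum>C\<in>{C \<in> copies H n. f C}. mset_set (edges C)) v" for f v
    using finite_copies by (intro vdegree_UN_le) (auto intro: copies_simple)
  then show ?thesis
    unfolding random_graph_eq random_multigraph_eq measure_map_pmf vimage_def mem_Collect_eq
      multi_min_degree_less_iff[OF assms] min_degree_less_iff[OF assms]
    by (intro measure_pmf.finite_measure_mono) (blast intro: le_less_trans, simp)
qed

text \<open>Since \<open>m1 \<ge> (n - 1) / h\<close>, the quotient is \<open>O(ln n / n)\<close>.
  The bounds keep the parameter clear of the clamping in \<open>bernoulli_pmf\<close> and within
  reach of \<open>one_minus_power_ge\<close>.\<close>

lemma eventually_p_bounds:
  assumes "eventually (\<lambda>n. ln (real n) / 2 \<le> a n \<and> a n \<le> 2 * ln (real n)) sequentially"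
  shows "eventually (\<lambda>n. m1 H n > 0 \<and> 0 < a n / real (m1 H n) \<and> a n / real (m1 H n) \<le> 1 / 2) sequentially"
proof -
  have lim: "(\<lambda>n. ln (real n) / (real n - 1)) \<longlonglongrightarrow> 0" by real_asymp
  have ev: "eventually (\<lambda>n. (2 * real h) * ln (real n) / (real n - 1) \<le> 1 / 2) sequentially"
    by (rule eventually_div_le[OF lim]) simp
  have ln2: "eventually (\<lambda>n. ln (real n) > 2) sequentially" by real_asymp
  have nh: "eventually (\<lambda>n. n \<ge> h) sequentially" by (rule eventually_ge_at_top)
  show ?thesis using assms ev ln2 nh
  proof eventually_elim
    case (elim n)
    let ?m = "real (m1 H n)"
    have n: "real n - 1 > 0" using elim h_ge_2 by auto
    have "real (n - 1) \<le> real ((h - 1) * m1 H n)" using m1_ge[OF elim(4)] by (rule of_nat_mono)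
    also have "\<dots> \<le> real h * ?m" unfolding of_nat_mult by (intro mult_right_mono) auto
    finally have nm: "real n - 1 \<le> real h * ?m" using n by (simp add: of_nat_diff)
    have m: "m1 H n > 0"
    proof (rule ccontr)
      assume "\<not> ?thesis"
      then show False using nm n by simp
    qed
    have "a n * (real n - 1) \<le> 2 * ln (real n) * (real h * ?m)"
      using elim nm n by (intro mult_mono) auto
    then have "a n / ?m \<le> (2 * real h) * ln (real n) / (real n - 1)"
      using n m by (simp add: field_simps)
    then have "a n / ?m \<le> 1 / 2" using elim(2) by linarith
    then show ?case using elim(1,3) m by simp
  qed
qed

text \<open>For each threshold this treats the model in which the claim is stronger: a lower bound
  on degrees in the simple graph, an upper bound in the multigraph.\<close>

lemma
  assumes d: "d \<ge> 1" and x: "filterlim x at_top sequentially" "x \<in> o(\<lambda>n. ln (ln (real n)))"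
  shows tendsto_prob_min_degree_less:
      "(\<lambda>n. measure_pmf.prob (random_graph H n (p_plus H d x n)) {G. min_degree G < d}) \<longlonglongrightarrow> 0"
    and tendsto_prob_multi_min_degree_ge:
      "(\<lambda>n. measure_pmf.prob (random_multigraph H n (p_minus H d x n))
        {G. \<not> multi_min_degree G < d}) \<longlonglongrightarrow> 0"
proof -
  define k where "k = nat (delta_d H d)"
  have k: "real_of_int (delta_d H d) = real k"
    using ceiling_div_min_degree_pos[OF d] by (simp add: k_def delta_d_def)
  have less_iff: "min_degree H * j < d \<longleftrightarrow> j < Suc k" for j
    unfolding k_def by (rule min_degree_mult_less_iff[OF d])
  define a where "a = (\<lambda>n. ln (real n) + (real k * ln (ln (real n)) + x n))"
  define b where "b = (\<lambda>n. ln (real n) + (real k * ln (ln (real n)) - x n))"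
  have "eventually (\<lambda>n. ln (real n) / 2 \<le> a n \<and> a n \<le> 2 * ln (real n)) sequentially"
    using eventually_ln_perturbed[OF x(2), of k] by (simp add: a_def)
  then have pa: "eventually (\<lambda>n. m1 H n > 0 \<and> 0 < a n / real (m1 H n) \<and> a n / real (m1 H n) \<le> 1 / 2) sequentially"
    by (rule eventually_p_bounds)
  have x': "(\<lambda>n. - x n) \<in> o(\<lambda>n. ln (ln (real n)))" using x(2) by simp
  have "eventually (\<lambda>n. ln (real n) / 2 \<le> b n \<and> b n \<le> 2 * ln (real n)) sequentially"
    using eventually_ln_perturbed[OF x', of k] by (simp add: b_def)
  then have pb: "eventually (\<lambda>n. m1 H n > 0 \<and> 0 < b n / real (m1 H n) \<and> b n / real (m1 H n) \<le> 1 / 2) sequentially"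
    by (rule eventually_p_bounds)
  have p_plus: "p_plus H d x n = a n / real (m1 H n)" for n
    by (simp add: p_plus_def a_def k add.assoc)
  have p_minus: "p_minus H d x n = b n / real (m1 H n)" for n
    by (simp add: p_minus_def b_def k)
  have n1: "eventually (\<lambda>n. n \<ge> 1) sequentially" by (rule eventually_ge_at_top)
  show "(\<lambda>n. measure_pmf.prob (random_graph H n (p_plus H d x n)) {G. min_degree G < d}) \<longlonglongrightarrow> 0"
  proof (rule tendsto_sandwich[where f = "\<lambda>_. 0"])
    show "eventually (\<lambda>n. measure_pmf.prob (random_graph H n (p_plus H d x n)) {G. min_degree G < d} \<le>
        real n * ((\<Sum>j<Suc k. a n ^ j) *
          exp (- a n + (real (Suc k) * real h * real h) * a n / real (n - 1)))) sequentially"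
      using pa n1
    proof eventually_elim
      case (elim n)
      have "p_plus H d x n * real (m1 H n) = a n" using elim(1) by (simp add: p_plus)
      moreover have "0 \<le> p_plus H d x n" "p_plus H d x n \<le> 1"
        unfolding p_plus using elim(1) by linarith+
      ultimately show ?case
        using prob_min_degree_less_le[OF elim(2), of "p_plus H d x n" d "Suc k"] less_iff
        by (simp only:)
    qed
    show "(\<lambda>n. real n * ((\<Sum>j<Suc k. a n ^ j) *
          exp (- a n + (real (Suc k) * real h * real h) * a n / real (n - 1)))) \<longlonglongrightarrow> 0"
      unfolding a_def by (rule first_moment_tendsto_0[OF x(2,1)]) simp
  qed auto
  have nh: "eventually (\<lambda>n. n \<ge> h) sequentially" by (rule eventually_ge_at_top)
  \<comment> \<open>Supplies the condition \<open>n - 1 \<ge> k * h\<^sup>2\<close> of the second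
    moment bound.\<close>
  have nk: "eventually (\<lambda>n. n \<ge> Suc (k * h\<^sup>2)) sequentially" by (rule eventually_ge_at_top)
  show "(\<lambda>n. measure_pmf.prob (random_multigraph H n (p_minus H d x n))
      {G. \<not> multi_min_degree G < d}) \<longlonglongrightarrow> 0"
  proof (rule tendsto_sandwich[where f = "\<lambda>_. 0"])
    show "eventually (\<lambda>n. measure_pmf.prob (random_multigraph H n (p_minus H d x n))
          {G. \<not> multi_min_degree G < d} \<le>
        1 / (real n * ((b n / (real h * real k)) ^ k *
          exp (- b n - 2 * real h * (b n)\<^sup>2 / (real n - 1)))) +
        (exp (4 * real h * b n / (real n - 1)) - 1)) sequentially"
      using pb nh nk
    proof eventually_elim
      case (elim n)
      have "real n \<ge> real (Suc (k * h\<^sup>2))" using elim(3) by (rule of_nat_mono)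
      then have "real k * (real h)\<^sup>2 \<le> real n - 1" by simp
      moreover have "p_minus H d x n * real (m1 H n) = b n"
        using elim(1) by (simp add: p_minus)
      moreover have "0 < p_minus H d x n" "p_minus H d x n \<le> 1 / 2"
        unfolding p_minus using elim(1) by blast+
      moreover have "min_degree H * k < d" by (simp add: less_iff)
      ultimately show ?case
        using prob_multi_min_degree_ge_le[of n k "p_minus H d x n" d] elim(2)
        by (simp only:)
    qed
    show "(\<lambda>n. 1 / (real n * ((b n / (real h * real k)) ^ k *
          exp (- b n - 2 * real h * (b n)\<^sup>2 / (real n - 1)))) +
        (exp (4 * real h * b n / (real n - 1)) - 1)) \<longlonglongrightarrow> 0"
      unfolding b_def using h_ge_2 by (intro second_moment_tendsto_0 x) auto
  qed auto
qed

end

section \<open>All four limits from the two stronger ones\<close>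

theorem theorem19:
  fixes H :: "'a ugraph" and d :: nat and x :: "nat \<Rightarrow> real"
  assumes "simple_graph H" and "verts H \<noteq> {}" and "no_isolated_vertices H"
    and "d \<ge> 1"
    and "filterlim x at_top sequentially"
    and "x \<in> o[sequentially](\<lambda>n. ln (ln (real n)))"
  shows "((\<lambda>n. measure_pmf.prob (random_graph H n (p_minus H d x n))
             {G. min_degree G < d}) \<longlonglongrightarrow> 1) \<and>
         ((\<lambda>n. measure_pmf.prob (random_graph H n (p_plus H d x n))
             {G. min_degree G \<ge> d}) \<longlonglongrightarrow> 1) \<and>
         ((\<lambda>n. measure_pmf.prob (random_multigraph H n (p_minus H d x n))
             {G. multi_min_degree G < d}) \<longlonglongrightarrow> 1) \<and>
         ((\<lambda>n. measure_pmf.prob (random_multigraph H n (p_plus H d x n))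
             {G. multi_min_degree G \<ge> d}) \<longlonglongrightarrow> 1)"
proof -
  interpret nonisolated_graph H
    using assms(1-3) by unfold_locales
  have compl: "measure_pmf.prob M {G. \<not> Q G} = 1 - measure_pmf.prob M {G. Q G}" for M :: "'b pmf" and Q
    using measure_pmf.prob_compl[of "{G. Q G}" M] by (simp add: Collect_neg_eq Compl_eq_Diff_UNIV)
  have n1: "eventually (\<lambda>n :: nat. n \<ge> 1) sequentially" by (rule eventually_ge_at_top)
  have "(\<lambda>n. 1 - measure_pmf.prob (random_graph H n (p_plus H d x n)) {G. min_degree G < d}) \<longlonglongrightarrow> 1 - 0"
    by (intro tendsto_intros tendsto_prob_min_degree_less assms)
  then have plus: "(\<lambda>n. measure_pmf.prob (random_graph H n (p_plus H d x n)) {G. min_degree G \<ge> d}) \<longlonglongrightarrow> 1"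
    unfolding compl[symmetric] by (simp add: not_less)
  have "(\<lambda>n. 1 - measure_pmf.prob (random_multigraph H n (p_minus H d x n)) {G. \<not> multi_min_degree G < d}) \<longlonglongrightarrow> 1 - 0"
    by (intro tendsto_intros tendsto_prob_multi_min_degree_ge assms)
  then have minus: "(\<lambda>n. measure_pmf.prob (random_multigraph H n (p_minus H d x n)) {G. multi_min_degree G < d}) \<longlonglongrightarrow> 1"
    by (simp only: compl) simp
  \<comment> \<open>Degrees in the simple graph are at most those in the multigraph, so this
    probability lies between the multigraph one and 1; the remaining multigraph limit is squeezed
    likewise.\<close>
  have "(\<lambda>n. measure_pmf.prob (random_graph H n (p_minus H d x n)) {G. min_degree G < d}) \<longlonglongrightarrow> 1"
  proof (rule tendsto_sandwich[OF _ _ minus tendsto_const])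
    show "eventually (\<lambda>n. measure_pmf.prob (random_multigraph H n (p_minus H d x n)) {G. multi_min_degree G < d} \<le>
        measure_pmf.prob (random_graph H n (p_minus H d x n)) {G. min_degree G < d}) sequentially"
      using n1 by eventually_elim (rule prob_multi_min_degree_less_le)
  qed auto
  moreover have "(\<lambda>n. measure_pmf.prob (random_multigraph H n (p_plus H d x n)) {G. multi_min_degree G \<ge> d}) \<longlonglongrightarrow> 1"
  proof (rule tendsto_sandwich[OF _ _ plus tendsto_const])
    show "eventually (\<lambda>n. measure_pmf.prob (random_graph H n (p_plus H d x n)) {G. min_degree G \<ge> d} \<le>
        measure_pmf.prob (random_multigraph H n (p_plus H d x n)) {G. multi_min_degree G \<ge> d}) sequentially"
      using n1
    proof eventually_elim
      case (elim n)
      show ?case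
        unfolding not_less[symmetric] compl
        using prob_multi_min_degree_less_le[OF elim, of "p_plus H d x n" d] by simp
    qed
  qed auto
  ultimately show ?thesis using plus minus by blast
qed

end
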